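(* Let $n,m,r,\lambda$ be positive integers with $m>4$ and $n\ge 4.847323\,m$. Any partial $r$-factorization of $\lambda K_m^4$ (with respect to $n$) can be extended to a connected $r$-factorization of $\lambda K_n^4$ if and only if $(n,r,\lambda)$ is $4$-admissible and no component of any color class of $\lambda K_m^4$ is $r$-regular.
   Context: $\lambda K_n^h$: $n$ vertices, every $h$-subset an edge of multiplicity $\lambda$; $\lambda K_m^h$ is its sub-hypergraph induced on a fixed set of $m$ vertices. Degree counts edges containing a vertex. An $r$-factor is a spanning sub-hypergraph in which every vertex has degree $r$. With $k=\lambda\binom{n-1}{h-1}/r$, a partial $r$-factorization of $\lambda K_m^h$ is a coloring of its edges with colors from $[k]$ such that each vertex has degree at most $r$ in every color class (color classes are spanning sub-hypergraphs on all $m$ vertices; components include isolated vertices). It extends to a connected $r$-factorization of $\lambda K_n^h$ if some coloring of all edges of $\lambda K_n^h$ with colors from $[k]$ agrees with it on $\lambda K_m^h$ and every color class is a connected $r$-factor. $(n,r,\lambda)$ is $h$-admissible if $h\mid rn$ and $r\mid\lambda\binom{n-1}{h-1}$. *)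

theory Defs
  imports Complex_Main "HOL-Library.FuncSet"
begin

text \<open>Edges of a multi-hypergraph are labelled: \<open>(S, j)\<close> is the \<open>j\<close>-th copy of the vertex set \<open>S\<close>.
  Parallel edges are thus distinct and may receive different colors.\<close>

type_synonym 'a hyperedge = "'a set \<times> nat"

datatype 'a hypergraph = Hypergraph (verts: "'a set") (edges: "'a hyperedge set")

definition complete_hypergraph :: "nat \<Rightarrow> nat \<Rightarrow> 'a set \<Rightarrow> 'a hypergraph" where
  "complete_hypergraph lam h V = Hypergraph V ({S. S \<subseteq> V \<and> card S = h} \<times> {..<lam})"

definition induced :: "'a hypergraph \<Rightarrow> 'a set \<Rightarrow> 'a hypergraph" where
  "induced H W = Hypergraph W {e \<in> edges H. fst e \<subseteq> W}"

lemma induced_complete_hypergraph: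
  "W \<subseteq> V \<Longrightarrow> induced (complete_hypergraph lam h V) W = complete_hypergraph lam h W"
  unfolding induced_def complete_hypergraph_def by auto

definition degree :: "'a hypergraph \<Rightarrow> 'a \<Rightarrow> nat" where
  "degree H v = card {e \<in> edges H. v \<in> fst e}"

definition regular :: "nat \<Rightarrow> 'a hypergraph \<Rightarrow> bool" where
  "regular r H \<longleftrightarrow> (\<forall>v \<in> verts H. degree H v = r)"

definition adjacent :: "'a hypergraph \<Rightarrow> 'a \<Rightarrow> 'a \<Rightarrow> bool" where
  "adjacent H u v \<longleftrightarrow> (\<exists>e \<in> edges H. u \<in> fst e \<and> v \<in> fst e)"

definition reachable :: "'a hypergraph \<Rightarrow> 'a \<Rightarrow> 'a \<Rightarrow> bool" where
  "reachable H = (adjacent H)\<^sup>*\<^sup>*"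

definition connected_hypergraph :: "'a hypergraph \<Rightarrow> bool" where
  "connected_hypergraph H \<longleftrightarrow>
     verts H \<noteq> {} \<and> (\<forall>u \<in> verts H. \<forall>v \<in> verts H. reachable H u v)"

text \<open>Reachability is reflexive, so an isolated vertex is a component without edges.\<close>

definition components :: "'a hypergraph \<Rightarrow> 'a hypergraph set" where
  "components H = (\<lambda>u. induced H {v \<in> verts H. reachable H u v}) ` verts H"

definition is_factor :: "nat \<Rightarrow> 'a hypergraph \<Rightarrow> 'a hypergraph \<Rightarrow> bool" where
  "is_factor r H F \<longleftrightarrow> verts F = verts H \<and> edges F \<subseteq> edges H \<and> regular r F"

definition color_class :: "'a hypergraph \<Rightarrow> ('a hyperedge \<Rightarrow> nat) \<Rightarrow> nat \<Rightarrow> 'a hypergraph" where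
  "color_class H c i = Hypergraph (verts H) {e \<in> edges H. c e = i}"

text \<open>Colors are the integers \<open>i\<close> with \<open>1 \<le> i \<le> lam * (n-1 choose h-1) / r\<close>. The integer division
  only rounds when \<open>r\<close> does not divide \<open>lam * (n-1 choose h-1)\<close>, i.e. in a non-admissible case.\<close>

definition num_colors :: "nat \<Rightarrow> nat \<Rightarrow> nat \<Rightarrow> nat \<Rightarrow> nat" where
  "num_colors h n r lam = (lam * ((n - 1) choose (h - 1))) div r"

definition admissible :: "nat \<Rightarrow> nat \<Rightarrow> nat \<Rightarrow> nat \<Rightarrow> bool" where
  "admissible h n r lam \<longleftrightarrow> h dvd r * n \<and> r dvd lam * ((n - 1) choose (h - 1))"

text \<open>A coloring is a total function of which only the values on edges matter. In the next two
  definitions \<open>k\<close> is the number of colors.\<close>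

definition partial_factorization ::
  "nat \<Rightarrow> nat \<Rightarrow> 'a hypergraph \<Rightarrow> ('a hyperedge \<Rightarrow> nat) \<Rightarrow> bool" where
  "partial_factorization k r H c \<longleftrightarrow>
     c \<in> edges H \<rightarrow> {1..k} \<and>
     (\<forall>i \<in> {1..k}. \<forall>v \<in> verts H. degree (color_class H c i) v \<le> r)"

definition connected_factorization ::
  "nat \<Rightarrow> nat \<Rightarrow> 'a hypergraph \<Rightarrow> ('a hyperedge \<Rightarrow> nat) \<Rightarrow> bool" where
  "connected_factorization k r H d \<longleftrightarrow>
     d \<in> edges H \<rightarrow> {1..k} \<and>
     (\<forall>i \<in> {1..k}. is_factor r H (color_class H d i) \<and> connected_hypergraph (color_class H d i))"

end

theory Submission
  imports Defs
begin

text \<open>Merge the vertices outside \<open>W\<close> into one vertex \<open>\<alpha>\<close>, so that an edge may meet \<open>\<alpha>\<close> several times.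
  First the colouring is extended to the merged hypergraph so that in every class the vertices of \<open>W\<close>
  have degree \<open>r\<close> and \<open>\<alpha>\<close> has degree \<open>r * (n - m)\<close>: edges with three or two vertices in \<open>W\<close> are coloured
  greedily, which is possible for \<open>n \<ge> 4.847323 m\<close>, and the others just fill the classes up.
  As no component of a class in \<open>W\<close> is \<open>r\<close>-regular, every class is now connected through \<open>\<alpha>\<close>.
  Then the vertices outside \<open>W\<close> are split off from \<open>\<alpha>\<close> one by one, as in Baranyai's theorem: a new vertex takes
  its fair share of the ends at \<open>\<alpha>\<close> from all classes, all types of edges and all pieces
  into which a class falls without \<open>\<alpha>\<close>. The shares are made integral by rounding a circulation, and
  the pieces are included in the rounding so as to keep the classes connected.\<close>

section \<open>Rounding\<close>

text \<open>The obstacle is connectivity. A new vertex may take the last end of a piece, and if it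
  did so with every piece it touches, it would be cut off from the rest of its class. Two facts
  prevent this. By a count of ends, no colour class ever has more pieces than a tree on the pieces
  and the vertices still to be detached allows. Moreover, in each class the new vertex touches a
  piece with at least two ends and leaves it one of them. This is why the rounding groups the ends
  by piece, by whether the piece has at least two ends, and by colour, next to the unrelated
  grouping by type of edge. Two such nested families of groups fit into one network, so integral
  shares exist.

  The constant comes from the greedy colouring. An edge with \<open>s\<close> vertices in
  \<open>W\<close> finds a colour if the edges with at least \<open>s\<close> vertices in
  \<open>W\<close> account for at most a fraction \<open>1 / s\<close> of each degree. For
  \<open>s = 3\<close> this holds from \<open>n = 4 * m\<close> on; \<open>s = 2\<close> is the
  bottleneck.\<close>

lemma nontrivial_solution:
  fixes A :: "'n \<Rightarrow> 'f \<Rightarrow> real"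
  assumes "finite N" "finite F" "card N < card F"
  shows "\<exists>y. (\<exists>f\<in>F. y f \<noteq> 0) \<and> (\<forall>n\<in>N. (\<Sum>f\<in>F. A n f * y f) = 0)"
  using assms
proof (induction N arbitrary: A F rule: finite_induct)
  case empty
  then obtain f where "f \<in> F" by fastforce
  then show ?case by (intro exI[of _ "\<lambda>_. 1"]) auto
next
  case (insert n N)
  show ?case
  proof (cases "\<forall>f\<in>F. A n f = 0")
    case True
    obtain y where y: "\<exists>f\<in>F. y f \<noteq> 0" "\<forall>n\<in>N. (\<Sum>f\<in>F. A n f * y f) = 0"
      using insert.IH[of F A] insert.prems insert.hyps by fastforce
    then show ?thesis using True by (intro exI[of _ y]) auto
  next
    case False
    then obtain g where g: "g \<in> F" "A n g \<noteq> 0" by auto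
    \<comment> \<open>Gaussian elimination: equation \<open>n\<close> removes the unknown
      \<open>g\<close> from the other equations, and afterwards \<open>w\<close> is the value of
      \<open>g\<close> that solves equation \<open>n\<close>.\<close>
    define B where "B m f = A m f - A m g * A n f / A n g" for m f
    have "card N < card (F - {g})" using insert.prems insert.hyps g by simp
    then obtain y where y: "\<exists>f\<in>F-{g}. y f \<noteq> 0" "\<forall>m\<in>N. (\<Sum>f\<in>F-{g}. B m f * y f) = 0"
      using insert.IH[of "F - {g}" B] insert.prems by auto
    define w where "w = - (\<Sum>f\<in>F-{g}. A n f * y f) / A n g"
    have split: "(\<Sum>f\<in>F. A m f * (y(g := w)) f) = A m g * w + (\<Sum>f\<in>F-{g}. A m f * y f)" for m
      using insert.prems g by (subst sum.remove[of _ g]) (auto intro!: sum.cong)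
    have "(\<Sum>f\<in>F. A m f * (y(g := w)) f) = 0" if "m \<in> insert n N" for m
    proof (cases "m = n")
      case True
      have "A n g * w + (\<Sum>f\<in>F-{g}. A n f * y f) = 0" using g by (simp add: w_def)
      then show ?thesis unfolding True split .
    next
      case False
      have "0 = (\<Sum>f\<in>F-{g}. B m f * y f)" using y(2) that False by simp
      also have "\<dots> = (\<Sum>f\<in>F-{g}. A m f * y f) - (\<Sum>f\<in>F-{g}. A m g / A n g * (A n f * y f))"
        unfolding B_def by (simp add: left_diff_distrib sum_subtractf mult.assoc)
      also have "\<dots> = (\<Sum>f\<in>F-{g}. A m f * y f) + A m g * w"
        unfolding w_def by (simp add: sum_distrib_left sum_divide_distrib)
      finally show ?thesis unfolding split by simp
    qed
    moreover have "\<exists>f\<in>F. (y(g := w)) f \<noteq> 0" using y(1) by auto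
    ultimately show ?thesis by blast
  qed
qed

text \<open>The value type is left open because a real circulation is to be rounded to an integral
  one.\<close>

definition circulation :: "'b set \<Rightarrow> ('b \<Rightarrow> 'n) \<Rightarrow> ('b \<Rightarrow> 'n) \<Rightarrow> ('b \<Rightarrow> 'v::comm_monoid_add) \<Rightarrow> bool" where
  "circulation A src dst x \<longleftrightarrow> (\<forall>v. (\<Sum>a | a \<in> A \<and> dst a = v. x a) = (\<Sum>a | a \<in> A \<and> src a = v. x a))"

text \<open>At every vertex that meets a fractional arc, at least two arc ends are fractional. Hence there
  are at least as many fractional arcs as such vertices, and since the conservation laws are linearly
  dependent, some nonzero circulation is supported on the fractional arcs.\<close>

lemma circulation_on_fractional_arcs:
  fixes x :: "'b \<Rightarrow> real" and src dst :: "'b \<Rightarrow> 'n"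
  assumes "finite A" and circ: "circulation A src dst x" and "\<exists>a\<in>A. x a \<notin> \<int>"
  shows "\<exists>y. circulation A src dst y \<and> (\<exists>a\<in>A. y a \<noteq> 0) \<and> (\<forall>a\<in>A. x a \<in> \<int> \<longrightarrow> y a = (0::real))"
proof -
  define F where "F = {a \<in> A. x a \<notin> \<int>}"
  define T where "T = dst ` F \<union> src ` F"
  have fF: "finite F" and fT: "finite T" using assms(1) by (auto simp: F_def T_def)
  have deg: "card {a \<in> F. dst a = v} + card {a \<in> F. src a = v} \<ge> 2" if "v \<in> T" for v
  proof (rule ccontr)
    assume neg: "\<not> ?thesis"
    have sums: "(\<Sum>a | a \<in> A \<and> f a = v. x a) =
        (\<Sum>a | a \<in> F \<and> f a = v. x a) + (\<Sum>a | a \<in> A - F \<and> f a = v. x a)" for f :: "'b \<Rightarrow> 'n"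
    proof -
      have "{a. a \<in> A \<and> f a = v} = {a. a \<in> F \<and> f a = v} \<union> {a. a \<in> A - F \<and> f a = v}"
        by (auto simp: F_def)
      then show ?thesis using assms(1) fF by (simp add: sum.union_disjoint Int_def)
    qed
    have int: "(\<Sum>a | a \<in> A - F \<and> f a = v. x a) \<in> \<int>" for f :: "'b \<Rightarrow> 'n"
      by (rule Ints_sum) (auto simp: F_def)
    have "(\<Sum>a | a \<in> F \<and> dst a = v. x a) - (\<Sum>a | a \<in> F \<and> src a = v. x a) =
      (\<Sum>a | a \<in> A - F \<and> src a = v. x a) - (\<Sum>a | a \<in> A - F \<and> dst a = v. x a)"
      using circ[unfolded circulation_def, rule_format, of v] sums[of dst] sums[of src] by linarith
    then have diff: "(\<Sum>a | a \<in> F \<and> dst a = v. x a) - (\<Sum>a | a \<in> F \<and> src a = v. x a) \<in> \<int>"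
      using int by simp
    have "{a \<in> F. dst a = v} \<noteq> {} \<or> {a \<in> F. src a = v} \<noteq> {}" using that by (auto simp: T_def)
    then have "card {a \<in> F. dst a = v} \<noteq> 0 \<or> card {a \<in> F. src a = v} \<noteq> 0" using fF by simp
    then consider "card {a \<in> F. dst a = v} = 1" "card {a \<in> F. src a = v} = 0"
      | "card {a \<in> F. dst a = v} = 0" "card {a \<in> F. src a = v} = 1"
      using neg by linarith
    then show False
    proof cases
      case 1
      then obtain a where a: "{a \<in> F. dst a = v} = {a}" by (auto simp: card_1_singleton_iff)
      have none: "{a \<in> F. src a = v} = {}" using 1 fF by simp
      have "x a \<in> \<int>" using diff unfolding a none by simp
      moreover have "a \<in> F" using a by auto
      ultimately show False by (simp add: F_def)
    next
      case 2
      then obtain a where a: "{a \<in> F. src a = v} = {a}" by (auto simp: card_1_singleton_iff)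
      have none: "{a \<in> F. dst a = v} = {}" using 2 fF by simp
      have "x a \<in> \<int>" using diff unfolding a none by simp
      moreover have "a \<in> F" using a by auto
      ultimately show False by (simp add: F_def)
    qed
  qed
  have cnt: "(\<Sum>v\<in>T. card {a \<in> F. f a = v}) = card F" if "f ` F \<subseteq> T" for f :: "'b \<Rightarrow> 'n"
    using sum.group[of F T f "\<lambda>_. 1::nat"] fF fT that by simp
  have "2 * card T = (\<Sum>v\<in>T. 2)" by simp
  also have "\<dots> \<le> (\<Sum>v\<in>T. card {a \<in> F. dst a = v} + card {a \<in> F. src a = v})"
    by (rule sum_mono) (rule deg)
  also have "\<dots> = 2 * card F"
    using cnt[of dst] cnt[of src] by (simp add: sum.distrib T_def)
  finally have TF: "card T \<le> card F" by simp
  obtain v0 where v0: "v0 \<in> T" using assms(3) by (auto simp: T_def F_def)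
  define M where "M v a = (if dst a = v then 1 else 0) - (if src a = v then 1 else (0::real))" for v a
  \<comment> \<open>The laws at the vertices of \<open>T\<close> add up to zero, so the law at
    \<open>v0\<close> follows from the others. Leaving it out makes the equations fewer than the
    unknowns.\<close>
  have "card (T - {v0}) < card F"
    using TF v0 fT by (meson card_Diff1_less le_trans less_le_trans)
  then obtain y0 where y0: "\<exists>f\<in>F. y0 f \<noteq> 0" "\<forall>v\<in>T-{v0}. (\<Sum>a\<in>F. M v a * y0 a) = 0"
    using nontrivial_solution[of "T - {v0}" F M] fF fT by auto
  define y where "y a = (if a \<in> F then y0 a else 0)" for a
  have inc: "(\<Sum>a | a \<in> A \<and> f a = v. y a) = (\<Sum>a\<in>F. (if f a = v then 1 else 0) * y0 a)" for f :: "'b \<Rightarrow> 'n" and v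
  proof -
    have "(\<Sum>a | a \<in> A \<and> f a = v. y a) = (\<Sum>a | a \<in> F \<and> f a = v. y0 a)"
      using assms(1) by (intro sum.mono_neutral_cong_right) (auto simp: F_def y_def)
    also have "\<dots> = (\<Sum>a\<in>F. (if f a = v then 1 else 0) * y0 a)"
      using fF by (intro sum.mono_neutral_cong_left) auto
    finally show ?thesis .
  qed
  have tot: "(\<Sum>v\<in>T. \<Sum>a\<in>F. M v a * y0 a) = 0"
  proof -
    have "(\<Sum>v\<in>T. M v a) = 0" if "a \<in> F" for a
      using that fT by (simp add: M_def sum_subtractf T_def)
    then show ?thesis
      by (subst sum.swap) (simp add: sum_distrib_right[symmetric])
  qed
  have zero: "(\<Sum>a\<in>F. M v a * y0 a) = 0" for v
  proof (cases "v \<in> T")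
    case True
    show ?thesis
    proof (cases "v = v0")
      case True
      then show ?thesis using tot y0(2) v0 fT by (simp add: sum.remove[of T v0])
    qed (use True y0 in auto)
  next
    case False
    then show ?thesis by (intro sum.neutral) (auto simp: M_def T_def)
  qed
  have "circulation A src dst y"
    unfolding circulation_def inc
    using zero by (simp add: M_def left_diff_distrib sum_subtractf)
  moreover have "\<exists>a\<in>A. y a \<noteq> 0" using y0(1) by (auto simp: y_def F_def)
  moreover have "\<forall>a\<in>A. x a \<in> \<int> \<longrightarrow> y a = 0" by (auto simp: y_def F_def)
  ultimately show ?thesis by blast
qed

text \<open>Move from \<open>x\<close> in direction \<open>y\<close>. In the proof
  \<open>s a\<close> is the time at which arc \<open>a\<close> reaches the next integer ahead of it.
  Stopping at the least of these times keeps every arc between its floor and ceiling and makes one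
  fractional arc integral.\<close>

lemma push_to_integer:
  fixes x y :: "'b \<Rightarrow> real"
  assumes "finite A" "\<exists>a\<in>A. y a \<noteq> 0" "\<forall>a\<in>A. x a \<in> \<int> \<longrightarrow> y a = 0"
  shows "\<exists>s. (\<forall>a\<in>A. \<lfloor>x a\<rfloor> \<le> x a + s * y a \<and> x a + s * y a \<le> \<lceil>x a\<rceil>) \<and>
    (\<exists>a\<in>A. x a \<notin> \<int> \<and> x a + s * y a \<in> \<int>)"
proof -
  define G where "G = {a \<in> A. y a \<noteq> 0}"
  define s where "s a = (if y a > 0 then (\<lceil>x a\<rceil> - x a) / y a else (\<lfloor>x a\<rfloor> - x a) / y a)" for a
  have G: "finite G" "G \<noteq> {}" using assms by (auto simp: G_def)
  define m where "m = Min (s ` G)"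
  have "m \<in> s ` G" using G by (simp add: m_def)
  then obtain b where b: "b \<in> G" "m = s b" by blast
  have le: "m \<le> s a" if "a \<in> G" for a using that G by (simp add: m_def)
  have "s b \<ge> 0" using b(1) by (auto simp: s_def G_def divide_nonpos_neg)
  then have m0: "m \<ge> 0" using b by simp
  have "\<lfloor>x a\<rfloor> \<le> x a + m * y a \<and> x a + m * y a \<le> \<lceil>x a\<rceil>" if "a \<in> A" for a
  proof (cases "y a" "0::real" rule: linorder_cases)
    case less
    then have "m \<le> (\<lfloor>x a\<rfloor> - x a) / y a" using le[of a] that by (simp add: s_def G_def)
    then have "m * y a \<ge> \<lfloor>x a\<rfloor> - x a" using less by (simp add: field_simps)
    moreover have "m * y a \<le> 0" using less m0 by (simp add: mult_nonneg_nonpos)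
    ultimately show ?thesis by linarith
  next
    case greater
    then have "m \<le> (\<lceil>x a\<rceil> - x a) / y a" using le[of a] that by (simp add: s_def G_def)
    then have "m * y a \<le> \<lceil>x a\<rceil> - x a" using greater by (simp add: field_simps)
    moreover have "m * y a \<ge> 0" using greater m0 by simp
    ultimately show ?thesis by linarith
  qed (simp add: field_simps, linarith?)
  moreover have "x b + m * y b \<in> \<int>"
    using b by (auto simp: s_def G_def)
  moreover have "b \<in> A" "x b \<notin> \<int>" using b assms(3) by (auto simp: G_def)
  ultimately show ?thesis by blast
qed

text \<open>Each push makes a further arc integral and moves no integral arc, so the number of
  fractional arcs drops. The interval from floor to ceiling of an arc can only shrink, so the final
  bounds refer to the original \<open>x\<close>.\<close>

lemma circulation_rounding:
  fixes x :: "'b \<Rightarrow> real" and src dst :: "'b \<Rightarrow> 'n"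
  assumes "finite A" "circulation A src dst x"
  shows "\<exists>z :: 'b \<Rightarrow> int. circulation A src dst z \<and> (\<forall>a\<in>A. \<lfloor>x a\<rfloor> \<le> z a \<and> z a \<le> \<lceil>x a\<rceil>)"
  using assms(2)
proof (induction "card {a \<in> A. x a \<notin> \<int>}" arbitrary: x rule: less_induct)
  case less
  show ?case
  proof (cases "\<exists>a\<in>A. x a \<notin> \<int>")
    case False
    have eq: "real_of_int \<lfloor>x a\<rfloor> = x a" if "a \<in> A" for a using False that by (simp add: of_int_floor)
    have "circulation A src dst (\<lambda>a. \<lfloor>x a\<rfloor>)"
      unfolding circulation_def
    proof
      fix v
      have sums: "real_of_int (\<Sum>a | a \<in> A \<and> f a = v. \<lfloor>x a\<rfloor>) = (\<Sum>a | a \<in> A \<and> f a = v. x a)" for f :: "'b \<Rightarrow> 'n"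
        by (simp add: eq)
      have "real_of_int (\<Sum>a | a \<in> A \<and> dst a = v. \<lfloor>x a\<rfloor>) = real_of_int (\<Sum>a | a \<in> A \<and> src a = v. \<lfloor>x a\<rfloor>)"
        unfolding sums using less.prems by (simp add: circulation_def)
      then show "(\<Sum>a | a \<in> A \<and> dst a = v. \<lfloor>x a\<rfloor>) = (\<Sum>a | a \<in> A \<and> src a = v. \<lfloor>x a\<rfloor>)" by (rule of_int_eq_iff[THEN iffD1])
    qed
    moreover have "\<forall>a\<in>A. \<lfloor>x a\<rfloor> \<le> \<lceil>x a\<rceil>" by (intro ballI) linarith
    ultimately show ?thesis by (intro exI[of _ "\<lambda>a. \<lfloor>x a\<rfloor>"]) simp
  next
    case True
    obtain y where y: "circulation A src dst y" "\<exists>a\<in>A. y a \<noteq> 0" "\<forall>a\<in>A. x a \<in> \<int> \<longrightarrow> y a = (0::real)"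
      using circulation_on_fractional_arcs[OF assms(1) less.prems True] by blast
    obtain s where s: "\<forall>a\<in>A. \<lfloor>x a\<rfloor> \<le> x a + s * y a \<and> x a + s * y a \<le> \<lceil>x a\<rceil>"
      "\<exists>a\<in>A. x a \<notin> \<int> \<and> x a + s * y a \<in> \<int>"
      using push_to_integer[OF assms(1) y(2,3)] by blast
    define x' where "x' a = x a + s * y a" for a
    have "{a \<in> A. x' a \<notin> \<int>} \<subset> {a \<in> A. x a \<notin> \<int>}"
      using s(2) y(3) by (auto simp: x'_def)
    then have dec: "card {a \<in> A. x' a \<notin> \<int>} < card {a \<in> A. x a \<notin> \<int>}"
      using assms(1) by (simp add: psubset_card_mono)
    have "circulation A src dst x'"
      using less.prems y(1) unfolding circulation_def x'_def
      by (simp add: sum.distrib sum_distrib_left[symmetric])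
    then obtain z :: "'b \<Rightarrow> int" where z: "circulation A src dst z" "\<forall>a\<in>A. \<lfloor>x' a\<rfloor> \<le> z a \<and> z a \<le> \<lceil>x' a\<rceil>"
      using less.hyps[OF dec] by blast
    have "\<lfloor>x a\<rfloor> \<le> z a \<and> z a \<le> \<lceil>x a\<rceil>" if "a \<in> A" for a
    proof -
      have "\<lfloor>x a\<rfloor> \<le> x' a" "x' a \<le> \<lceil>x a\<rceil>" using s(1) that by (auto simp: x'_def)
      then have "\<lfloor>x a\<rfloor> \<le> \<lfloor>x' a\<rfloor>" "\<lceil>x' a\<rceil> \<le> \<lceil>x a\<rceil>" by (simp_all add: le_floor_iff ceiling_le_iff)
      then show ?thesis using z(2) that by fastforce
    qed
    then show ?thesis using z(1) by blast
  qed
qed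

text \<open>The network of the next lemma. Item \<open>e\<close> runs around a cycle from
  \<open>Root\<close> through \<open>Part (p e)\<close>, \<open>Fine (q e)\<close>,
  \<open>Mid (g (q e))\<close> and \<open>Coarse (l (g (q e)))\<close> back to \<open>Root\<close>,
  and sending \<open>x e\<close> around each cycle gives a circulation. Every arc other than an item
  then carries the sum of one group, so rounding the circulation rounds all group sums at
  once.\<close>

datatype ('s, 'b, 'c, 'd) vertex = Root | Part 's | Fine 'b | Mid 'c | Coarse 'd

datatype ('e, 's, 'b, 'c, 'd) arc = Item 'e | FromRoot 's | FromFine 'b | FromMid 'c | FromCoarse 'd

lemma nested_rounding:
  fixes x :: "'e \<Rightarrow> real" and p :: "'e \<Rightarrow> 's" and q :: "'e \<Rightarrow> 'b" and g :: "'b \<Rightarrow> 'c" and l :: "'c \<Rightarrow> 'd"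
  assumes fE: "finite E" and x01: "\<And>e. e \<in> E \<Longrightarrow> 0 \<le> x e \<and> x e \<le> 1"
  defines "near y k \<equiv> \<lfloor>y\<rfloor> \<le> int k \<and> int k \<le> \<lceil>y :: real\<rceil>"
  shows "\<exists>J\<subseteq>E.
    (\<forall>s. near (\<Sum>e | e \<in> E \<and> p e = s. x e) (card {e \<in> J. p e = s})) \<and>
    (\<forall>b. near (\<Sum>e | e \<in> E \<and> q e = b. x e) (card {e \<in> J. q e = b})) \<and>
    (\<forall>c. near (\<Sum>e | e \<in> E \<and> g (q e) = c. x e) (card {e \<in> J. g (q e) = c})) \<and>
    (\<forall>d. near (\<Sum>e | e \<in> E \<and> l (g (q e)) = d. x e) (card {e \<in> J. l (g (q e)) = d}))"
proof -
  define tail where "tail a = (case a of Item e \<Rightarrow> Part (p e) | FromRoot s \<Rightarrow> Root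
    | FromFine b \<Rightarrow> Fine b | FromMid c \<Rightarrow> Mid c | FromCoarse d \<Rightarrow> Coarse d)" for a :: "('e,'s,'b,'c,'d) arc"
  define head where "head a = (case a of Item e \<Rightarrow> Fine (q e) | FromRoot s \<Rightarrow> Part s
    | FromFine b \<Rightarrow> Mid (g b) | FromMid c \<Rightarrow> Coarse (l c) | FromCoarse d \<Rightarrow> Root)" for a :: "('e,'s,'b,'c,'d) arc"
  define A where "A = Item ` E \<union> FromRoot ` p ` E \<union> FromFine ` q ` E \<union> FromMid ` g ` q ` E
    \<union> FromCoarse ` l ` g ` q ` E"
  define X where "X a = (case a of Item e \<Rightarrow> x e | FromRoot s \<Rightarrow> (\<Sum>e | e \<in> E \<and> p e = s. x e)
    | FromFine b \<Rightarrow> (\<Sum>e | e \<in> E \<and> q e = b. x e) | FromMid c \<Rightarrow> (\<Sum>e | e \<in> E \<and> g (q e) = c. x e)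
    | FromCoarse d \<Rightarrow> (\<Sum>e | e \<in> E \<and> l (g (q e)) = d. x e))" for a
  have fA: "finite A" using fE by (simp add: A_def)
  note defs = tail_def head_def A_def
  have tails:
    "{a. a \<in> A \<and> tail a = Root} = FromRoot ` p ` E"
    "\<And>s. {a. a \<in> A \<and> tail a = Part s} = Item ` {e \<in> E. p e = s}"
    "\<And>b. {a. a \<in> A \<and> tail a = Fine b} = FromFine ` (q ` E \<inter> {b})"
    "\<And>c. {a. a \<in> A \<and> tail a = Mid c} = FromMid ` (g ` q ` E \<inter> {c})"
    "\<And>d. {a. a \<in> A \<and> tail a = Coarse d} = FromCoarse ` (l ` g ` q ` E \<inter> {d})"
    unfolding defs by auto
  have heads:
    "{a. a \<in> A \<and> head a = Root} = FromCoarse ` l ` g ` q ` E"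
    "\<And>s. {a. a \<in> A \<and> head a = Part s} = FromRoot ` (p ` E \<inter> {s})"
    "\<And>b. {a. a \<in> A \<and> head a = Fine b} = Item ` {e \<in> E. q e = b}"
    "\<And>c. {a. a \<in> A \<and> head a = Mid c} = FromFine ` {b \<in> q ` E. g b = c}"
    "\<And>d. {a. a \<in> A \<and> head a = Coarse d} = FromMid ` {c \<in> g ` q ` E. l c = d}"
    unfolding defs by auto
  have grp: "(\<Sum>b | b \<in> f ` E \<and> P b. \<Sum>e | e \<in> E \<and> f e = b. x e) = (\<Sum>e | e \<in> E \<and> P (f e). x e)"
    for f :: "'e \<Rightarrow> 'z" and P
  proof -
    have "(\<Sum>b | b \<in> f ` E \<and> P b. \<Sum>e | e \<in> {e \<in> E. P (f e)} \<and> f e = b. x e) = (\<Sum>e | e \<in> E \<and> P (f e). x e)"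
      by (rule sum.group) (use fE in auto)
    moreover have "(\<Sum>e | e \<in> {e \<in> E. P (f e)} \<and> f e = b. x e) = (\<Sum>e | e \<in> E \<and> f e = b. x e)" if "P b" for b
      by (rule sum.cong) (use that in auto)
    ultimately show ?thesis by simp
  qed
  have grp1: "(\<Sum>b\<in>f ` E. \<Sum>e | e \<in> E \<and> f e = b. x e) = sum x E" for f :: "'e \<Rightarrow> 'z"
    using grp[of f "\<lambda>_. True"] by simp
  have empty: "(\<Sum>e | e \<in> E \<and> f e = b. x e) = 0" if "b \<notin> f ` E" for b and f :: "'e \<Rightarrow> 'z"
    by (rule sum.neutral) (use that in auto)
  have inter: "B \<inter> {b} = (if b \<in> B then {b} else {})" for B and b :: 'z by auto
  have "circulation A tail head X"
    unfolding circulation_def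
  proof
    fix v
    show "sum X {a. a \<in> A \<and> head a = v} = sum X {a. a \<in> A \<and> tail a = v}"
    proof (cases v)
      case Root
      have "(\<Sum>d\<in>l ` g ` q ` E. \<Sum>e | e \<in> E \<and> l (g (q e)) = d. x e) = sum x E"
        using grp1[of "\<lambda>e. l (g (q e))"] by (simp add: image_image)
      then show ?thesis unfolding Root heads tails
        using grp1[of p] by (simp add: sum.reindex inj_on_def X_def)
    next
      case (Part s)
      then show ?thesis unfolding Part heads tails inter
        using empty[of s p] by (auto simp: sum.reindex inj_on_def X_def)
    next
      case (Fine b)
      then show ?thesis unfolding Fine heads tails inter
        using empty[of b q] by (auto simp: sum.reindex inj_on_def X_def)
    next
      case (Mid c)
      then show ?thesis unfolding Mid heads tails inter
        using empty[of c "\<lambda>e. g (q e)"] grp[of q "\<lambda>b. g b = c"]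
        by (auto simp: sum.reindex inj_on_def X_def image_image)
    next
      case (Coarse d)
      then show ?thesis unfolding Coarse heads tails inter
        using empty[of d "\<lambda>e. l (g (q e))"] grp[of "\<lambda>e. g (q e)" "\<lambda>b. l b = d"]
        by (auto simp: sum.reindex inj_on_def X_def image_image)
    qed
  qed
  then obtain z :: "_ \<Rightarrow> int" where z: "circulation A tail head z" "\<forall>a\<in>A. \<lfloor>X a\<rfloor> \<le> z a \<and> z a \<le> \<lceil>X a\<rceil>"
    using circulation_rounding[OF fA] by blast
  have zc: "sum z {a. a \<in> A \<and> head a = v} = sum z {a. a \<in> A \<and> tail a = v}" for v
    using z(1) unfolding circulation_def by blast
  have z01: "z (Item e) = 0 \<or> z (Item e) = 1" if "e \<in> E" for e
  proof -
    have "\<lfloor>x e\<rfloor> \<le> z (Item e) \<and> z (Item e) \<le> \<lceil>x e\<rceil>"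
      using z(2)[rule_format, of "Item e"] that by (auto simp: A_def X_def)
    moreover have "\<lfloor>x e\<rfloor> \<ge> 0" "\<lceil>x e\<rceil> \<le> 1" using x01[OF that] by (simp_all add: le_floor_iff ceiling_le_iff)
    ultimately show ?thesis by linarith
  qed
  \<comment> \<open>Since the shares lie between 0 and 1, rounding an item arc accepts or rejects
    the item. Conservation turns the values on the other arcs into numbers of accepted
    items.\<close>
  define J where "J = {e \<in> E. z (Item e) = 1}"
  have J: "(\<Sum>e | e \<in> E \<and> P e. z (Item e)) = int (card {e \<in> J. P e})" for P
  proof -
    have "(\<Sum>e | e \<in> E \<and> P e. z (Item e)) = (\<Sum>e | e \<in> J \<and> P e. 1)"
      by (rule sum.mono_neutral_cong_right) (use fE z01 in \<open>auto simp: J_def\<close>)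
    then show ?thesis by simp
  qed
  have "z (FromRoot s) = (\<Sum>e | e \<in> E \<and> p e = s. z (Item e))" if "s \<in> p ` E" for s
    using zc[of "Part s"] that unfolding heads tails inter by (simp add: sum.reindex inj_on_def)
  note zp = this
  have zq: "z (FromFine b) = (\<Sum>e | e \<in> E \<and> q e = b. z (Item e))" if "b \<in> q ` E" for b
    using zc[of "Fine b"] that unfolding heads tails inter by (simp add: sum.reindex inj_on_def)
  have grpz: "(\<Sum>b | b \<in> f ` E \<and> P b. \<Sum>e | e \<in> E \<and> f e = b. z (Item e)) = (\<Sum>e | e \<in> E \<and> P (f e). z (Item e))"
    for f :: "'e \<Rightarrow> 'z" and P
  proof -
    have "(\<Sum>b | b \<in> f ` E \<and> P b. \<Sum>e | e \<in> {e \<in> E. P (f e)} \<and> f e = b. z (Item e)) = (\<Sum>e | e \<in> E \<and> P (f e). z (Item e))"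
      by (rule sum.group) (use fE in auto)
    moreover have "(\<Sum>e | e \<in> {e \<in> E. P (f e)} \<and> f e = b. z (Item e)) = (\<Sum>e | e \<in> E \<and> f e = b. z (Item e))" if "P b" for b
      by (rule sum.cong) (use that in auto)
    ultimately show ?thesis by simp
  qed
  have zg: "z (FromMid c) = (\<Sum>e | e \<in> E \<and> g (q e) = c. z (Item e))" if "c \<in> g ` q ` E" for c
    using zc[of "Mid c"] that grpz[of q "\<lambda>b. g b = c"] zq unfolding heads tails inter
    by (simp add: sum.reindex inj_on_def)
  have zl: "z (FromCoarse d) = (\<Sum>e | e \<in> E \<and> l (g (q e)) = d. z (Item e))" if "d \<in> l ` g ` q ` E" for d
    using zc[of "Coarse d"] that grpz[of "\<lambda>e. g (q e)" "\<lambda>b. l b = d"] zg unfolding heads tails inter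
    by (simp add: sum.reindex inj_on_def image_image)
  \<comment> \<open>Only nonempty groups have arcs in the network; for an empty group both numbers
    are 0.\<close>
  have fin: "near (\<Sum>e | e \<in> E \<and> f e = b. x e) (card {e \<in> J. f e = b})"
    if "b \<in> f ` E \<Longrightarrow> \<lfloor>\<Sum>e | e \<in> E \<and> f e = b. x e\<rfloor> \<le> (\<Sum>e | e \<in> E \<and> f e = b. z (Item e)) \<and>
       (\<Sum>e | e \<in> E \<and> f e = b. z (Item e)) \<le> \<lceil>\<Sum>e | e \<in> E \<and> f e = b. x e\<rceil>" for f :: "'e \<Rightarrow> 'z" and b
  proof (cases "b \<in> f ` E")
    case True
    then show ?thesis using that unfolding near_def J by blast
  next
    case False
    then have "{e \<in> J. f e = b} = {}" by (auto simp: J_def)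
    then show ?thesis unfolding near_def empty[OF False] by (simp del: Collect_empty_eq)
  qed
  show ?thesis
  proof (intro exI[of _ J] conjI allI)
    show "J \<subseteq> E" by (auto simp: J_def)
    show "near (\<Sum>e | e \<in> E \<and> p e = s. x e) (card {e \<in> J. p e = s})" for s
      using z(2)[rule_format, of "FromRoot s"] zp[of s] by (intro fin) (auto simp: A_def X_def)
    show "near (\<Sum>e | e \<in> E \<and> q e = b. x e) (card {e \<in> J. q e = b})" for b
      using z(2)[rule_format, of "FromFine b"] zq[of b] by (intro fin) (auto simp: A_def X_def)
    show "near (\<Sum>e | e \<in> E \<and> g (q e) = c. x e) (card {e \<in> J. g (q e) = c})" for c
      using z(2)[rule_format, of "FromMid c"] zg[of c] by (intro fin) (auto simp: A_def X_def)
    show "near (\<Sum>e | e \<in> E \<and> l (g (q e)) = d. x e) (card {e \<in> J. l (g (q e)) = d})" for d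
      using z(2)[rule_format, of "FromCoarse d"] zl[of d] by (intro fin) (auto simp: A_def X_def)
  qed
qed

text \<open>The shares are \<open>w e / T\<close>. The two inequalities in \<open>near\<close> say
  without division that \<open>k\<close> differs from \<open>W / T\<close> by less than 1; in
  particular \<open>k\<close> is exact whenever \<open>T\<close> divides \<open>W\<close>.\<close>

lemma nested_rounding_multiples:
  fixes w :: "'e \<Rightarrow> nat" and p :: "'e \<Rightarrow> 's" and q :: "'e \<Rightarrow> 'b" and g :: "'b \<Rightarrow> 'c" and l :: "'c \<Rightarrow> 'd"
  assumes "finite E" "T > 0" "\<And>e. e \<in> E \<Longrightarrow> w e \<le> T"
  defines "near W k \<equiv> k * T < W + T \<and> W < k * T + T"
  shows "\<exists>J\<subseteq>E.
    (\<forall>s. near (\<Sum>e | e \<in> E \<and> p e = s. w e) (card {e \<in> J. p e = s})) \<and>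
    (\<forall>b. near (\<Sum>e | e \<in> E \<and> q e = b. w e) (card {e \<in> J. q e = b})) \<and>
    (\<forall>c. near (\<Sum>e | e \<in> E \<and> g (q e) = c. w e) (card {e \<in> J. g (q e) = c})) \<and>
    (\<forall>d. near (\<Sum>e | e \<in> E \<and> l (g (q e)) = d. w e) (card {e \<in> J. l (g (q e)) = d}))"
proof -
  have near: "near W k" if "\<lfloor>real W / real T\<rfloor> \<le> int k \<and> int k \<le> \<lceil>real W / real T\<rceil>" for W k
  proof -
    have "real k < real W / real T + 1" "real W / real T < real k + 1" using that by linarith+
    then have "real k * real T < real W + real T" "real W < (real k + 1) * real T"
      using assms(2) by (simp_all add: field_simps)
    then have "real (k * T) < real (W + T)" "real W < real (k * T + T)" by (simp_all add: algebra_simps)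
    then show ?thesis unfolding near_def by linarith
  qed
  have sums: "(\<Sum>e | e \<in> E \<and> P e. real (w e) / real T) = real (\<Sum>e | e \<in> E \<and> P e. w e) / real T" for P
    by (simp add: sum_divide_distrib)
  have "0 \<le> real (w e) / real T \<and> real (w e) / real T \<le> 1" if "e \<in> E" for e
    using assms(3)[OF that] assms(2) by simp
  from nested_rounding[of E "\<lambda>e. real (w e) / real T" p q g l, OF assms(1) this, unfolded sums]
  show ?thesis using near by meson
qed

section \<open>Detachments\<close>

text \<open>The classes of this relation are the pieces of a colour class without the amalgamated
  vertex. They consist of edges rather than vertices, so that an edge with all its ends at the
  amalgamated vertex is a piece of its own. The intersection with \<open>F \<times> F\<close>
  removes the loops that the reflexive closure adds outside \<open>F\<close>.\<close>

definition linked :: "'e set \<Rightarrow> ('e \<Rightarrow> 'a set) \<Rightarrow> 'e rel" where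
  "linked F \<tau> = {(e, f). e \<in> F \<and> f \<in> F \<and> \<tau> e \<inter> \<tau> f \<noteq> {}}\<^sup>* \<inter> F \<times> F"

lemma equiv_linked: "equiv F (linked F \<tau>)"
proof (rule equivI)
  let ?R = "{(e, f). e \<in> F \<and> f \<in> F \<and> \<tau> e \<inter> \<tau> f \<noteq> {}}"
  show "linked F \<tau> \<subseteq> F \<times> F" by (auto simp: linked_def)
  show "refl_on F (linked F \<tau>)" by (auto simp: linked_def refl_on_def)
  have "sym ?R" by (auto simp: sym_def)
  then have "sym (?R\<^sup>*)" by (rule sym_rtrancl)
  then show "sym (linked F \<tau>)" unfolding linked_def by (auto simp: sym_def)
  show "trans (linked F \<tau>)" unfolding linked_def trans_def by (auto intro: rtrancl_trans)
qed

lemma linkedI: "e \<in> F \<Longrightarrow> f \<in> F \<Longrightarrow> v \<in> \<tau> e \<Longrightarrow> v \<in> \<tau> f \<Longrightarrow> (e, f) \<in> linked F \<tau>"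
  unfolding linked_def by (auto intro!: r_into_rtrancl)

lemma linked_mono:
  assumes "\<And>e. e \<in> F \<Longrightarrow> \<tau> e \<subseteq> \<tau>' e"
  shows "linked F \<tau> \<subseteq> linked F \<tau>'"
proof -
  have "{(e, f). e \<in> F \<and> f \<in> F \<and> \<tau> e \<inter> \<tau> f \<noteq> {}} \<subseteq> {(e, f). e \<in> F \<and> f \<in> F \<and> \<tau>' e \<inter> \<tau>' f \<noteq> {}}"
    using assms by fast
  then show ?thesis unfolding linked_def using rtrancl_mono by blast
qed

text \<open>All classes of \<open>R\<close> that \<open>J\<close> meets end up in a single class of
  \<open>R'\<close>, called \<open>B\<close> in the proof. Every other class of \<open>R'\<close> is
  generated by a class of \<open>R\<close> that \<open>J\<close> misses.\<close>

lemma card_quotient_merge: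
  assumes "finite F" and R: "equiv F R" and R': "equiv F R'" and "R \<subseteq> R'" and "J \<subseteq> F" and "J \<times> J \<subseteq> R'"
  shows "card (F // R') + card {C \<in> F // R. J \<inter> C \<noteq> {}} \<le> card (F // R) + 1"
proof -
  define M where "M = {C \<in> F // R. J \<inter> C = {}}"
  define B where "B = \<Union>((\<lambda>e. R' `` {e}) ` J)"
  have fin: "finite (F // R)" using R assms(1) by (simp add: finite_quotient equiv_type)
  have "F // R' \<subseteq> insert B ((\<lambda>C. R' `` C) ` M)"
  proof
    fix C' assume "C' \<in> F // R'"
    then obtain e where e: "e \<in> F" "C' = R' `` {e}" by (auto elim: quotientE)
    show "C' \<in> insert B ((\<lambda>C. R' `` C) ` M)"
    proof (cases "J \<inter> R `` {e} = {}")
      case True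
      have "R' `` {e} = R' `` (R `` {e})"
      proof -
        have "R' `` {f} = R' `` {e}" if "(e, f) \<in> R" for f
          using that equiv_class_eq[OF R', of e f] \<open>R \<subseteq> R'\<close> by auto
        moreover have "e \<in> R `` {e}" using equiv_class_self[OF R e(1)] .
        ultimately show ?thesis by blast
      qed
      moreover have "R `` {e} \<in> M" using True e by (simp add: M_def quotientI)
      ultimately show ?thesis using e by blast
    next
      case False
      then obtain f where f: "f \<in> J" "(e, f) \<in> R" by auto
      have "R' `` {g} = C'" if "g \<in> J" for g
      proof -
        have "(e, f) \<in> R'" "(f, g) \<in> R'" using f that \<open>R \<subseteq> R'\<close> \<open>J \<times> J \<subseteq> R'\<close> by auto
        then show ?thesis using equiv_class_eq[OF R', of e f] equiv_class_eq[OF R', of f g] e(2) by simp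
      qed
      then have "C' = B" using f by (auto simp: B_def)
      then show ?thesis by simp
    qed
  qed
  moreover have "finite M" using fin by (simp add: M_def)
  ultimately have "card (F // R') \<le> card M + 1"
    by (metis (no_types, lifting) Suc_eq_plus1 card_image_le card_insert_le_m1 card_mono diff_Suc_1
        finite_imageI finite_insert le_trans zero_less_Suc)
  moreover have "card (F // R) = card M + card {C \<in> F // R. J \<inter> C \<noteq> {}}"
    unfolding M_def using fin by (subst card_Un_disjoint[symmetric]) (auto intro: arg_cong[of _ _ card])
  ultimately show ?thesis by simp
qed

lemma sum_quotient:
  assumes "finite F" "equiv F R"
  shows "(\<Sum>C\<in>F // R. sum f C) = sum f F"
proof -
  have "sum f (\<Union>(F // R)) = (\<Sum>C\<in>F // R. sum f C)"
    using assms sum.Union_disjoint[of "F // R" f] quotient_disj[OF assms(2)]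
    by (metis Union_quotient finite_Union finite_subset Union_upper comp_apply)
  then show ?thesis using assms by (simp add: Union_quotient)
qed

text \<open>One colour class in a detachment step: \<open>w e\<close> counts the ends of \<open>e\<close> at the amalgamated vertex,
  which is split into a vertex taking the ends selected by \<open>J\<close> and one of degree \<open>r * u\<close>.
  A connected detachment into \<open>u + 1\<close> vertices of degree \<open>r\<close> needs at least as many ends at the
  amalgamated vertex as a tree has edges whose vertices are these \<open>u + 1\<close> vertices and the classes
  of \<open>R\<close>. This is the bound on \<open>card (F // R)\<close>, and it is what the step preserves.\<close>

lemma detachment_step_colour:
  fixes w :: "'e \<Rightarrow> nat"
  assumes fF: "finite F" and R: "equiv F R" and R': "equiv F R'" and sub: "R \<subseteq> R'"
    and JF: "J \<subseteq> F" and JJ: "J \<times> J \<subseteq> R'" and u: "u \<ge> 1" and r: "r \<ge> 1"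
    and total: "sum w F = r * Suc u"
    and ends: "\<forall>e\<in>F. \<exists>f. (e, f) \<in> R \<and> w f > 0"
    and few: "card (F // R) \<le> (r - 1) * Suc u + 1"
    and cJ: "card J = r"
    and near: "\<And>C. C \<in> F // R \<Longrightarrow> card (J \<inter> C) * Suc u < sum w C + Suc u"
    and big: "(\<Sum>C | C \<in> F // R \<and> sum w C \<ge> 2. sum w C) \<ge> Suc u \<Longrightarrow>
       \<exists>C\<in>F // R. sum w C \<ge> 2 \<and> J \<inter> C \<noteq> {}"
    and w': "\<And>e. e \<in> F \<Longrightarrow> w' e = w e - (if e \<in> J then 1 else 0)"
  shows "\<forall>e\<in>F. \<exists>f. (e, f) \<in> R' \<and> w' f > (0::nat)" and "card (F // R') \<le> (r - 1) * u + 1"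
proof -
  define Q where "Q = F // R"
  \<comment> \<open>\<open>X\<close> counts the ends beyond one per piece. As the ends number
    \<open>r * Suc u\<close>, the bound on the number of pieces is the same as
    \<open>X \<ge> u\<close>.\<close>
  define X where "X = (\<Sum>C\<in>Q. sum w C - 1)"
  have fQ: "finite Q" using R fF by (simp add: finite_quotient Q_def equiv_type)
  have CF: "C \<subseteq> F" if "C \<in> Q" for C using that R by (auto simp: Q_def equiv_def elim!: quotientE)
  have fC: "finite C" if "C \<in> Q" for C using CF[OF that] fF by (rule finite_subset)
  have pos: "sum w C \<ge> 1" if CQ: "C \<in> Q" for C
  proof -
    obtain e where e: "e \<in> F" "C = R `` {e}" using CQ unfolding Q_def by (rule quotientE)
    then obtain f where "f \<in> C" "w f > 0" using ends by auto
    then show ?thesis using fC[OF CQ] by (metis member_le_sum less_one linorder_not_le order_less_le_trans zero_le)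
  qed
  have dsum: "(\<Sum>C\<in>Q. sum w C) = r * Suc u" unfolding Q_def using sum_quotient[OF fF R, of w] total by simp
  have X: "X + card Q = r * Suc u"
  proof -
    have "(\<Sum>C\<in>Q. sum w C) = (\<Sum>C\<in>Q. (sum w C - 1) + 1)"
      by (rule sum.cong) (auto dest!: pos)
    also have "\<dots> = X + card Q" unfolding X_def sum.distrib by simp
    finally show ?thesis using dsum by simp
  qed
  have rr: "r * Suc u = (r - 1) * Suc u + Suc u" using r by (cases r) auto
  have Xu: "X \<ge> u" using X few rr unfolding Q_def by simp
  have Jsum: "(\<Sum>C\<in>Q. card (J \<inter> C)) = r"
  proof -
    have "card (J \<inter> C) = (\<Sum>e\<in>C. if e \<in> J then 1 else 0)" if "C \<in> Q" for C
      using fC[OF that] by (simp add: sum.If_cases Int_commute)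
    then have "(\<Sum>C\<in>Q. card (J \<inter> C)) = (\<Sum>e\<in>F. if e \<in> J then 1 else 0)"
      using sum_quotient[OF fF R, of "\<lambda>e. if e \<in> J then 1 else 0"] unfolding Q_def by simp
    also have "\<dots> = card J" using fF JF by (simp add: sum.If_cases Int_absorb1)
    finally show ?thesis using cJ by simp
  qed
  have few1: "card (J \<inter> C) - 1 \<le> (sum w C - 1) div Suc u" if "C \<in> Q" for C
  proof (cases "card (J \<inter> C)")
    case (Suc k)
    then have "k * Suc u \<le> sum w C - 1" using near[of C] that pos[OF that] by (simp add: Q_def)
    then show ?thesis using Suc by (metis diff_Suc_1 div_le_mono nonzero_mult_div_cancel_right nat.distinct(1))
  qed auto
  define A where "A = card {C \<in> Q. J \<inter> C \<noteq> {}}"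
  have rA: "r = (\<Sum>C\<in>Q. card (J \<inter> C) - 1) + A"
  proof -
    have "card (J \<inter> C) = (card (J \<inter> C) - 1) + (if J \<inter> C \<noteq> {} then 1 else 0)" if "C \<in> Q" for C
    proof (cases "J \<inter> C = {}")
      case False
      then have "card (J \<inter> C) > 0" using fC[OF that] by (simp add: card_gt_0_iff)
      then show ?thesis using False by simp
    qed simp
    then have "r = (\<Sum>C\<in>Q. (card (J \<inter> C) - 1) + (if J \<inter> C \<noteq> {} then 1 else 0))"
      using Jsum by (metis (no_types, lifting) sum.cong)
    also have "\<dots> = (\<Sum>C\<in>Q. card (J \<inter> C) - 1) + A"
      using fQ by (simp add: sum.distrib sum.If_cases A_def Collect_conj_eq Int_commute)
    finally show ?thesis .
  qed
  \<comment> \<open>The ends that \<open>J\<close> wastes on pieces it has already met are bounded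
    by \<open>X - u\<close>: each piece contributes at most its surplus divided by
    \<open>Suc u\<close>. Hence \<open>J\<close> meets at least \<open>r - (X - u)\<close> pieces,
    and merging them lowers the number of pieces enough for the new bound.\<close>
  have "(\<Sum>C\<in>Q. card (J \<inter> C) - 1) \<le> (\<Sum>C\<in>Q. (sum w C - 1) div Suc u)"
    by (rule sum_mono) (rule few1)
  also have "\<dots> \<le> X div Suc u"
  proof -
    have "Suc u * (\<Sum>C\<in>Q. (sum w C - 1) div Suc u) \<le> X"
      unfolding X_def sum_distrib_left by (rule sum_mono) (rule times_div_less_eq_dividend)
    then show ?thesis by (metis div_le_mono nonzero_mult_div_cancel_left nat.distinct(1))
  qed
  also have "\<dots> \<le> X - u"
  proof (cases "X < Suc u")
    case False
    define a where "a = X div Suc u"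
    have "a \<ge> 1" using False by (simp add: a_def div_greater_zero_iff Suc_le_eq)
    then have au: "a * u \<ge> u" by simp
    have "a * Suc u \<le> X" unfolding a_def by (rule div_times_less_eq_dividend)
    then have "a + a * u \<le> X" by simp
    then show ?thesis unfolding a_def[symmetric] using au by linarith
  qed simp
  finally have "r \<le> X - u + A" using rA by simp
  moreover have "card (F // R') + A \<le> card Q + 1"
    unfolding A_def Q_def by (rule card_quotient_merge[OF fF R R' sub JF JJ])
  moreover have "(r - 1) * u + u = r * u" using r by (cases r) auto
  ultimately show "card (F // R') \<le> (r - 1) * u + 1" using X Xu by simp

  \<comment> \<open>The pieces with at least two ends carry the whole surplus
    \<open>X \<ge> u\<close> and, as there is at least one of them, more than \<open>X\<close> ends
    in total. So their weight is at least \<open>Suc u\<close>, and \<open>big\<close>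
    applies.\<close>
  have "\<exists>C\<in>Q. sum w C \<ge> 2 \<and> J \<inter> C \<noteq> {}"
    unfolding Q_def
  proof (rule big)
    have "X = (\<Sum>C | C \<in> Q \<and> sum w C \<ge> 2. sum w C - 1)"
      unfolding X_def using fQ by (intro sum.mono_neutral_right) auto
    moreover have "\<dots> < (\<Sum>C | C \<in> Q \<and> sum w C \<ge> 2. sum w C)"
    proof (rule sum_strict_mono)
      show "{C. C \<in> Q \<and> sum w C \<ge> 2} \<noteq> {}" using calculation Xu u by force
    qed (use fQ in auto)
    ultimately show "(\<Sum>C | C \<in> F // R \<and> sum w C \<ge> 2. sum w C) \<ge> Suc u"
      using Xu by (simp add: Q_def)
  qed
  then obtain C where C: "C \<in> Q" "sum w C \<ge> 2" "J \<inter> C \<noteq> {}" by blast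
  have "card (J \<inter> C) - 1 \<le> (sum w C - 1) div 2"
    using few1[OF C(1)] div_le_mono2[of 2 "Suc u" "sum w C - 1"] u by simp
  \<comment> \<open>Here \<open>u \<ge> 1\<close> matters: the divisor \<open>Suc u\<close> is at
    least 2, so a fair share cannot exhaust a piece with two or more ends.\<close>
  then have lt: "card (J \<inter> C) < sum w C" using C(2) by linarith
  have "\<exists>f\<in>C. w' f > 0"
  proof (rule ccontr)
    assume no: "\<not> ?thesis"
    have "w f \<le> (if f \<in> J then 1 else 0)" if "f \<in> C" for f
      using no that w'[of f] CF[OF C(1)] by fastforce
    then have "sum w C \<le> (\<Sum>f\<in>C. if f \<in> J then 1 else 0)" by (rule sum_mono)
    also have "\<dots> = card (J \<inter> C)" using fC[OF C(1)] by (simp add: sum.If_cases Int_commute)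
    finally show False using lt by simp
  qed
  then obtain f where f: "f \<in> C" "w' f > 0" by blast
  obtain e1 where e1: "e1 \<in> J" "e1 \<in> C" using C by blast
  have e1f: "(e1, f) \<in> R'" using quotient_eq_iff[OF R, of C C e1 f] C(1) e1 f sub by (auto simp: Q_def)
  show "\<forall>e\<in>F. \<exists>f. (e, f) \<in> R' \<and> w' f > 0"
  proof
    fix e assume e: "e \<in> F"
    obtain g where g: "(e, g) \<in> R" "w g > 0" using ends e by blast
    show "\<exists>f. (e, f) \<in> R' \<and> w' f > 0"
    proof (cases "J \<inter> R `` {e} = {}")
      case True
      have "g \<in> F" using R g(1) by (auto simp: equiv_def)
      then have "w' g > 0" using True g w'[of g] by auto
      then show ?thesis using g sub by blast
    next
      case False
      then obtain g' where "g' \<in> J" "(e, g') \<in> R" by auto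
      then have "(e, g') \<in> R'" "(g', e1) \<in> R'" using sub JJ e1 by auto
      then have "(e, f) \<in> R'" using e1f R' by (meson equivE transD)
      then show ?thesis using f by blast
    qed
  qed
qed

text \<open>An amalgamated factorization: \<open>t\<close> vertices outside \<open>U\<close> have been merged into one vertex, so an
  edge \<open>e\<close> consists of its vertices \<open>\<tau> e\<close> in \<open>U\<close> and of \<open>h - card (\<tau> e)\<close> ends at the merged vertex.\<close>

definition amalgam :: "nat \<Rightarrow> nat \<Rightarrow> nat \<Rightarrow> 'e set \<Rightarrow> ('e \<Rightarrow> 'k) \<Rightarrow> 'k set \<Rightarrow> 'a set \<Rightarrow> nat \<Rightarrow> ('e \<Rightarrow> 'a set) \<Rightarrow> bool"
  where "amalgam h r lam E col K U t \<tau> \<longleftrightarrow>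
    (\<forall>e\<in>E. \<tau> e \<subseteq> U \<and> card (\<tau> e) \<le> h) \<and>
    (\<forall>S. S \<subseteq> U \<and> card S \<le> h \<longrightarrow> card {e \<in> E. \<tau> e = S} = lam * (t choose (h - card S))) \<and>
    (\<forall>j\<in>K. let F = {e \<in> E. col e = j} in
      (\<forall>v\<in>U. card {e \<in> F. v \<in> \<tau> e} = r) \<and> (\<Sum>e\<in>F. h - card (\<tau> e)) = r * t \<and>
      (\<forall>e\<in>F. \<exists>f. (e, f) \<in> linked F \<tau> \<and> h - card (\<tau> f) > 0) \<and>
      card (F // linked F \<tau>) \<le> (r - 1) * t + 1)"

text \<open>The new vertex \<open>x\<close> is owed the share \<open>w e / Suc u\<close> of each
  edge \<open>e\<close>. Summed over a type of edge or over a colour, the shares are integers, so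
  rounding realizes exactly the multiplicities and the degree required of \<open>x\<close>. For the
  pieces, rounding up to less than one end is all that \<open>detachment_step_colour\<close> asks
  for.\<close>

lemma detachment_step:
  assumes am: "amalgam h r lam E col K U (Suc u) \<tau>"
    and fE: "finite E" and fU: "finite U" and xU: "x \<notin> U" and u: "u \<ge> 1" and r: "r \<ge> 1"
    and colK: "col ` E \<subseteq> K"
  shows "\<exists>\<tau>'. amalgam h r lam E col K (insert x U) u \<tau>' \<and> (\<forall>e\<in>E. card (\<tau> e) = h \<longrightarrow> \<tau>' e = \<tau> e)"
proof -
  define w where "w e = h - card (\<tau> e)" for e
  define F where "F j = {e \<in> E. col e = j}" for j
  define R where "R j = linked (F j) \<tau>" for j
  define cl where "cl e = R (col e) `` {e}" for e
  have fF: "finite (F j)" for j using fE by (simp add: F_def)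
  have R: "equiv (F j) (R j)" for j unfolding R_def by (rule equiv_linked)
  have tr: "\<tau> e \<subseteq> U" "card (\<tau> e) \<le> h" "finite (\<tau> e)" if "e \<in> E" for e
    using am that finite_subset[OF _ fU] unfolding amalgam_def by auto
  have fib: "card {e \<in> E. \<tau> e = S} = lam * (Suc u choose (h - card S))" if "S \<subseteq> U" "card S \<le> h" for S
    using am that unfolding amalgam_def by blast
  have colour: "\<forall>v\<in>U. card {e \<in> F j. v \<in> \<tau> e} = r" "(\<Sum>e\<in>F j. w e) = r * Suc u"
     "\<forall>e\<in>F j. \<exists>f. (e, f) \<in> R j \<and> w f > 0" "card (F j // R j) \<le> (r - 1) * Suc u + 1" if "j \<in> K" for j
    using am that unfolding amalgam_def F_def R_def w_def Let_def by blast+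
  \<comment> \<open>The shares must not exceed 1 for \<open>J\<close> to be a set of edges. An edge
    with more than \<open>Suc u\<close> ends at the amalgamated vertex does not occur, because its
    type has multiplicity a vanishing binomial coefficient.\<close>
  have wle: "w e \<le> Suc u" if e: "e \<in> E" for e
  proof (rule ccontr)
    assume "\<not> ?thesis"
    then have "card {e' \<in> E. \<tau> e' = \<tau> e} = 0" using fib[OF tr(1,2)[OF e]] by (simp add: w_def)
    then show False using e fE by auto
  qed
  \<comment> \<open>\<open>J1\<close> treats the types of edges, \<open>J2\<close> the pieces,
    \<open>J3\<close> the pieces of a colour split by whether they have at least two ends, and
    \<open>J4\<close> the colours. Of \<open>J2\<close> only the upper and of \<open>J3\<close> only
    the lower estimate is kept.\<close>
  obtain J where JE: "J \<subseteq> E" and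
    J1: "\<And>S. card {e \<in> J. \<tau> e = S} * Suc u < (\<Sum>e | e \<in> E \<and> \<tau> e = S. w e) + Suc u \<and>
       (\<Sum>e | e \<in> E \<and> \<tau> e = S. w e) < card {e \<in> J. \<tau> e = S} * Suc u + Suc u" and
    J2: "\<And>b. card {e \<in> J. (col e, cl e) = b} * Suc u < (\<Sum>e | e \<in> E \<and> (col e, cl e) = b. w e) + Suc u" and
    J3: "\<And>c. (\<Sum>e | e \<in> E \<and> (\<lambda>(j, C). (j, sum w C \<ge> 2)) (col e, cl e) = c. w e) <
       card {e \<in> J. (\<lambda>(j, C). (j, sum w C \<ge> 2)) (col e, cl e) = c} * Suc u + Suc u" and
    J4: "\<And>j. card {e \<in> J. fst ((\<lambda>(j, C). (j, sum w C \<ge> 2)) (col e, cl e)) = j} * Suc u <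
         (\<Sum>e | e \<in> E \<and> fst ((\<lambda>(j, C). (j, sum w C \<ge> 2)) (col e, cl e)) = j. w e) + Suc u \<and>
       (\<Sum>e | e \<in> E \<and> fst ((\<lambda>(j, C). (j, sum w C \<ge> 2)) (col e, cl e)) = j. w e) <
         card {e \<in> J. fst ((\<lambda>(j, C). (j, sum w C \<ge> 2)) (col e, cl e)) = j} * Suc u + Suc u"
    using nested_rounding_multiples[of E "Suc u" w \<tau> "\<lambda>e. (col e, cl e)" "\<lambda>(j, C). (j, sum w C \<ge> 2)" fst] fE wle
    by (auto simp del: mult_Suc_right)
  have fJ: "finite J" using JE fE by (rule finite_subset)
  have exact: "k = q" if "k * Suc u < q * Suc u + Suc u \<and> q * Suc u < k * Suc u + Suc u" for k q
  proof -
    have "k * Suc u < Suc q * Suc u" "q * Suc u < Suc k * Suc u" using that by simp_all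
    then have "k < Suc q" "q < Suc k" by (metis mult_less_cancel2)+
    then show ?thesis by simp
  qed
  have wS: "(\<Sum>e | e \<in> E \<and> \<tau> e = S. w e) = lam * (Suc u choose (h - card S)) * (h - card S)"
    if "S \<subseteq> U" "card S \<le> h" for S
  proof -
    have "(\<Sum>e | e \<in> E \<and> \<tau> e = S. w e) = (\<Sum>e | e \<in> E \<and> \<tau> e = S. h - card S)"
      by (rule sum.cong) (auto simp: w_def)
    then show ?thesis using fib[OF that] by simp
  qed
  \<comment> \<open>The absorption identity for binomial coefficients makes the weight of the type
    divisible by \<open>Suc u\<close>, and the quotient is the number of edges that are to consist
    of \<open>S\<close>, \<open>x\<close> and ends at the remaining amalgamated vertex.\<close>
  have Jfib: "card {e \<in> J. \<tau> e = S} = lam * (u choose (h - card S - 1))" if S: "S \<subseteq> U" "card S < h" for S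
  proof -
    have "(Suc u choose (h - card S)) * (h - card S) = (u choose (h - card S - 1)) * Suc u"
      using times_binomial_minus1_eq[of "h - card S" "Suc u"] S by (simp add: mult.commute)
    then show ?thesis using J1[of S] wS[of S] S
      by (intro exact) (simp add: mult.assoc del: mult_Suc mult_Suc_right)
  qed
  have Jw: "w e > 0" if "e \<in> J" for e
  proof (rule ccontr)
    assume "\<not> ?thesis"
    then have "w e = 0" "card (\<tau> e) = h" using tr(2)[of e] that JE by (auto simp: w_def)
    then have "card {e' \<in> J. \<tau> e' = \<tau> e} * Suc u < Suc u" using J1[of "\<tau> e"] wS[of "\<tau> e"] tr[of e] that JE by auto
    then have "card {e' \<in> J. \<tau> e' = \<tau> e} = 0" by (cases "card {e' \<in> J. \<tau> e' = \<tau> e}") auto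
    then show False using that fJ by auto
  qed
  define \<tau>' where "\<tau>' e = (if e \<in> J then insert x (\<tau> e) else \<tau> e)" for e
  have xt: "x \<notin> \<tau> e" if "e \<in> E" for e using tr(1)[OF that] xU by blast
  have ct: "card (\<tau>' e) = card (\<tau> e) + (if e \<in> J then 1 else 0)" if "e \<in> E" for e
    using xt[OF that] tr(3)[OF that] by (simp add: \<tau>'_def)
  have w': "h - card (\<tau>' e) = w e - (if e \<in> J then 1 else 0)" if "e \<in> E" for e
    using ct[OF that] by (simp add: w_def)
  have cl: "{e \<in> J. (col e, cl e) = (j, C)} = J \<inter> C" "{e \<in> E. (col e, cl e) = (j, C)} = C"
    if "C \<in> F j // R j" for j C
  proof -
    have "e \<in> E \<and> col e = j \<and> cl e = C \<longleftrightarrow> e \<in> C" for e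
    proof
      assume e: "e \<in> E \<and> col e = j \<and> cl e = C"
      then have "e \<in> R j `` {e}" using equiv_class_self[OF R, of e j] by (simp add: F_def)
      then show "e \<in> C" using e by (metis cl_def)
    next
      assume e: "e \<in> C"
      have eF: "e \<in> F j" using e that R Union_quotient by blast
      have "R j `` {e} \<in> F j // R j" using eF by (rule quotientI)
      moreover have "e \<in> R j `` {e}" using equiv_class_self[OF R eF] .
      ultimately have "R j `` {e} = C" using quotient_disj[OF R _ that] e by blast
      then show "e \<in> E \<and> col e = j \<and> cl e = C" using eF by (auto simp: F_def cl_def)
    qed
    then show "{e \<in> J. (col e, cl e) = (j, C)} = J \<inter> C" "{e \<in> E. (col e, cl e) = (j, C)} = C"
      using JE by blast+
  qed
  have ccol: "card (J \<inter> F j) = r" if "j \<in> K" for j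
  proof (rule exact)
    have "{e \<in> J. fst ((\<lambda>(j, C). (j, sum w C \<ge> 2)) (col e, cl e)) = j} = J \<inter> F j"
      "{e \<in> E. fst ((\<lambda>(j, C). (j, sum w C \<ge> 2)) (col e, cl e)) = j} = F j"
      using JE by (auto simp: F_def)
    then show "card (J \<inter> F j) * Suc u < r * Suc u + Suc u \<and> r * Suc u < card (J \<inter> F j) * Suc u + Suc u"
      using J4[of j] colour(2)[OF that] by simp
  qed
  have step: "(\<forall>e\<in>F j. \<exists>f. (e, f) \<in> linked (F j) \<tau>' \<and> h - card (\<tau>' f) > 0) \<and>
      card (F j // linked (F j) \<tau>') \<le> (r - 1) * u + 1" if j: "j \<in> K" for j
  proof -
    have sub: "R j \<subseteq> linked (F j) \<tau>'" unfolding R_def by (rule linked_mono) (auto simp: \<tau>'_def)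
    have JJ: "(J \<inter> F j) \<times> (J \<inter> F j) \<subseteq> linked (F j) \<tau>'"
      by (auto intro!: linkedI[where v = x] simp: \<tau>'_def)
    have sJ: "J \<inter> C = J \<inter> F j \<inter> C" if "C \<in> F j // R j" for C
      using cl(2)[OF that] by (auto simp: F_def)
    have near: "card (J \<inter> F j \<inter> C) * Suc u < sum w C + Suc u" if "C \<in> F j // R j" for C
      using J2[of "(j, C)"] cl[OF that] sJ[OF that] by simp
    have big: "\<exists>C\<in>F j // R j. sum w C \<ge> 2 \<and> J \<inter> F j \<inter> C \<noteq> {}"
      if D: "(\<Sum>C | C \<in> F j // R j \<and> sum w C \<ge> 2. sum w C) \<ge> Suc u"
    proof -
      \<comment> \<open>\<open>?G e\<close> says that \<open>e\<close> lies in a piece of colour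
        \<open>j\<close> with at least two ends. The weight of these edges is that of one group in
        \<open>J3\<close>; once it reaches \<open>Suc u\<close>, its rounding is positive.\<close>
      let ?G = "\<lambda>e. (\<lambda>(j, C). (j, sum w C \<ge> 2)) (col e, cl e) = (j, True)"
      have "(\<Sum>C | C \<in> F j // R j \<and> sum w C \<ge> 2. sum w C) = (\<Sum>C\<in>F j // R j. \<Sum>e\<in>C. if ?G e then w e else 0)"
      proof -
        have "(\<Sum>e\<in>C. if ?G e then w e else 0) = (if sum w C \<ge> 2 then sum w C else 0)" if C: "C \<in> F j // R j" for C
        proof -
          have "?G e \<longleftrightarrow> sum w C \<ge> 2" if "e \<in> C" for e using cl(2)[OF C] that by auto
          then show ?thesis by (simp cong: sum.cong)
        qed
        moreover have "finite (F j // R j)" using R fF by (simp add: finite_quotient equiv_type)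
        ultimately show ?thesis by (simp add: sum.inter_filter)
      qed
      also have "\<dots> = (\<Sum>e\<in>F j. if ?G e then w e else 0)"
        by (rule sum_quotient[OF fF R])
      also have "\<dots> = (\<Sum>e | e \<in> E \<and> ?G e. w e)"
        using fF[of j] by (subst sum.inter_filter[symmetric]) (auto simp: F_def intro!: sum.cong)
      finally have "(\<Sum>e | e \<in> E \<and> ?G e. w e) \<ge> Suc u" using D by simp
      then have "card {e \<in> J. ?G e} > 0" using J3[of "(j, True)"] by (intro gr0I) simp
      then have "{e \<in> J. ?G e} \<noteq> {}" by (metis card.empty less_irrefl)
      then obtain e where "e \<in> J" "?G e" by blast
      then have e: "e \<in> J" "e \<in> F j" "sum w (cl e) \<ge> 2" using JE by (auto simp: F_def)
      then have "cl e = R j `` {e}" by (simp add: cl_def F_def)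
      then have "cl e \<in> F j // R j" "e \<in> cl e"
        using equiv_class_self[OF R e(2)] e(2) by (auto intro: quotientI)
      then show ?thesis using e by blast
    qed
    have w'F: "h - card (\<tau>' e) = w e - (if e \<in> J \<inter> F j then 1 else 0)" if "e \<in> F j" for e
      using that w'[of e] by (auto simp: F_def)
    show ?thesis
      using detachment_step_colour[OF fF R equiv_linked sub _ JJ u r colour(2,3,4)[OF j] ccol[OF j] near big w'F]
      by blast
  qed
  have "amalgam h r lam E col K (insert x U) u \<tau>'"
    unfolding amalgam_def Let_def F_def[symmetric]
  proof (intro conjI ballI allI impI)
    fix e assume e: "e \<in> E"
    show "\<tau>' e \<subseteq> insert x U" using tr(1)[OF e] by (auto simp: \<tau>'_def)
    show "card (\<tau>' e) \<le> h" using ct[OF e] tr(2)[OF e] Jw[of e] by (auto simp: w_def)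
  next
    fix S assume S: "S \<subseteq> insert x U \<and> card S \<le> h"
    then have fS: "finite S" using fU finite_subset by blast
    show "card {e \<in> E. \<tau>' e = S} = lam * (u choose (h - card S))"
    proof (cases "x \<in> S")
      case True
      have "{e \<in> E. \<tau>' e = S} = {e \<in> J. \<tau> e = S - {x}}"
        using True xt JE by (auto simp: \<tau>'_def split: if_splits)
      moreover have "S - {x} \<subseteq> U" "card (S - {x}) < h" "h - card (S - {x}) - 1 = h - card S"
      proof -
        have "card S = Suc (card (S - {x}))" using card_Suc_Diff1[OF fS True] by (rule sym)
        then show "card (S - {x}) < h" "h - card (S - {x}) - 1 = h - card S" using S by auto
      qed (use S in auto)
      ultimately show ?thesis using Jfib by simp
    next
      case False
      then have SU: "S \<subseteq> U" using S by blast
      have "{e \<in> E. \<tau>' e = S} = {e \<in> E. \<tau> e = S} - {e \<in> J. \<tau> e = S}"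
        using False by (auto simp: \<tau>'_def split: if_splits)
      moreover have "{e \<in> J. \<tau> e = S} \<subseteq> {e \<in> E. \<tau> e = S}" using JE by auto
      ultimately have "card {e \<in> E. \<tau>' e = S} = lam * (Suc u choose (h - card S)) - card {e \<in> J. \<tau> e = S}"
        using fib[OF SU] S fJ by (simp add: card_Diff_subset)
      also have "\<dots> = lam * (u choose (h - card S))"
      proof (cases "card S = h")
        case True
        then have "{e \<in> J. \<tau> e = S} = {}" using Jw by (auto simp: w_def)
        then have "card {e \<in> J. \<tau> e = S} = 0" by (simp only: card.empty)
        then show ?thesis using True by simp
      next
        case False
        then obtain k where "h - card S = Suc k" using S by (metis Suc_diff_Suc le_neq_implies_less)
        then show ?thesis using Jfib[OF SU] False S by (simp add: algebra_simps)
      qed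
      finally show ?thesis .
    qed
  next
    fix j v assume j: "j \<in> K" and v: "v \<in> insert x U"
    show "card {e \<in> F j. v \<in> \<tau>' e} = r"
    proof (cases "v = x")
      case True
      have "{e \<in> F j. v \<in> \<tau>' e} = J \<inter> F j" using True xt by (auto simp: F_def \<tau>'_def)
      then show ?thesis using ccol[OF j] by simp
    next
      case False
      then have "{e \<in> F j. v \<in> \<tau>' e} = {e \<in> F j. v \<in> \<tau> e}" by (auto simp: \<tau>'_def)
      then show ?thesis using colour(1)[OF j] v False by auto
    qed
  next
    fix j assume j: "j \<in> K"
    have "(\<Sum>e\<in>F j. h - card (\<tau>' e)) + (\<Sum>e\<in>F j. if e \<in> J then 1 else 0) = (\<Sum>e\<in>F j. w e)"
      unfolding sum.distrib[symmetric]
    proof (rule sum.cong)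
      fix e assume "e \<in> F j"
      then show "h - card (\<tau>' e) + (if e \<in> J then 1 else 0) = w e"
        using w'[of e] Jw[of e] by (auto simp: F_def)
    qed simp
    then show "(\<Sum>e\<in>F j. h - card (\<tau>' e)) = r * u"
      using colour(2)[OF j] ccol[OF j] fF[of j] by (simp add: sum.If_cases Int_commute)
  qed (use step in auto)
  moreover have "\<tau>' e = \<tau> e" if "e \<in> E" "card (\<tau> e) = h" for e
    using Jw[of e] that by (auto simp: \<tau>'_def w_def)
  ultimately show ?thesis by blast
qed

text \<open>The induction stops with one vertex \<open>z\<close> still amalgamated, because
  \<open>detachment_step\<close> must leave at least one vertex to hold the pieces together.\<close>

lemma detachment:
  assumes "amalgam h r lam E col K U (Suc u) \<tau>" "finite E" "finite V" "U \<subseteq> V" "card (V - U) = Suc u"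
    "r \<ge> 1" "col ` E \<subseteq> K"
  shows "\<exists>z \<tau>'. z \<in> V - U \<and> amalgam h r lam E col K (V - {z}) 1 \<tau>' \<and> (\<forall>e\<in>E. card (\<tau> e) = h \<longrightarrow> \<tau>' e = \<tau> e)"
  using assms(1,4,5)
proof (induction u arbitrary: U \<tau>)
  case 0
  then obtain z where z: "V - U = {z}" by (auto simp: card_1_singleton_iff)
  then have "V - {z} = U" using 0 by blast
  then show ?case using 0 z by auto
next
  case (Suc u)
  then have "V - U \<noteq> {}" by (metis card.empty nat.distinct(1))
  then obtain x where x: "x \<in> V - U" by blast
  obtain \<tau>1 where t1: "amalgam h r lam E col K (insert x U) (Suc u) \<tau>1" "\<forall>e\<in>E. card (\<tau> e) = h \<longrightarrow> \<tau>1 e = \<tau> e"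
    using detachment_step[OF Suc.prems(1) assms(2) finite_subset[OF Suc.prems(2) assms(3)] _ _ assms(6,7), of x] x
    by auto
  have "card (V - insert x U) = Suc u"
    using Suc.prems x assms(3) by (metis Diff_insert card_Diff_singleton diff_Suc_1)
  then obtain z \<tau>' where "z \<in> V - insert x U" "amalgam h r lam E col K (V - {z}) 1 \<tau>'"
    "\<forall>e\<in>E. card (\<tau>1 e) = h \<longrightarrow> \<tau>' e = \<tau>1 e"
    using Suc.IH[OF t1(1)] Suc.prems x by auto
  then show ?case using t1(2) by (intro exI[of _ z] exI[of _ \<tau>']) auto
qed

text \<open>Once a single vertex is left to be detached, the amalgamated vertex can be renamed to it.\<close>

lemma detachment_complete:
  assumes am: "amalgam h r lam E col K U (Suc u) \<tau>" and fE: "finite E" and fV: "finite V"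
    and UV: "U \<subseteq> V" and cV: "card (V - U) = Suc u" and r: "r \<ge> 1" and h: "h \<ge> 1" and colK: "col ` E \<subseteq> K"
  shows "\<exists>\<sigma>. (\<forall>e\<in>E. \<sigma> e \<subseteq> V \<and> card (\<sigma> e) = h) \<and>
    (\<forall>e\<in>E. card (\<tau> e) = h \<longrightarrow> \<sigma> e = \<tau> e) \<and>
    (\<forall>S. S \<subseteq> V \<and> card S = h \<longrightarrow> card {e \<in> E. \<sigma> e = S} = lam) \<and>
    (\<forall>j\<in>K. (\<forall>v\<in>V. card {e \<in> E. col e = j \<and> v \<in> \<sigma> e} = r) \<and>
      (\<forall>e\<in>E. \<forall>f\<in>E. col e = j \<and> col f = j \<longrightarrow> (e, f) \<in> linked {e \<in> E. col e = j} \<sigma>))"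
proof -
  obtain z \<tau>' where z: "z \<in> V" and am': "amalgam h r lam E col K (V - {z}) 1 \<tau>'"
    and keep: "\<forall>e\<in>E. card (\<tau> e) = h \<longrightarrow> \<tau>' e = \<tau> e"
    using detachment[OF am fE fV UV cV r colK] by blast
  have tr: "\<tau>' e \<subseteq> V - {z}" "card (\<tau>' e) \<le> h" "finite (\<tau>' e)" if "e \<in> E" for e
    using am' that fV finite_subset[of "\<tau>' e" "V - {z}"] unfolding amalgam_def by auto
  have fib: "card {e \<in> E. \<tau>' e = S} = lam * (1 choose (h - card S))" if "S \<subseteq> V - {z}" "card S \<le> h" for S
    using am' that unfolding amalgam_def by blast
  \<comment> \<open>With one vertex left, the multiplicity \<open>1 choose (h - card S)\<close> is 0
    for types with two or more ends, so no edge contains \<open>z\<close> twice.\<close>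
  have w1: "h - card (\<tau>' e) \<le> 1" if e: "e \<in> E" for e
  proof (rule ccontr)
    assume "\<not> ?thesis"
    then have "card {e' \<in> E. \<tau>' e' = \<tau>' e} = 0" using fib[OF tr(1,2)[OF e]] by simp
    then show False using e fE by auto
  qed
  define \<sigma> where "\<sigma> e = (if card (\<tau>' e) = h then \<tau>' e else insert z (\<tau>' e))" for e
  have zt: "z \<notin> \<tau>' e" if "e \<in> E" for e using tr(1)[OF that] by blast
  have z\<sigma>: "z \<in> \<sigma> e \<longleftrightarrow> h - card (\<tau>' e) = 1" if "e \<in> E" for e
    using zt[OF that] w1[OF that] tr(2)[OF that] by (auto simp: \<sigma>_def)
  have sub: "\<sigma> e \<subseteq> V" "card (\<sigma> e) = h" if "e \<in> E" for e
    using tr[OF that] w1[OF that] zt[OF that] z by (auto simp: \<sigma>_def)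
  have fibS: "card {e \<in> E. \<sigma> e = S} = lam" if S: "S \<subseteq> V" "card S = h" for S
  proof (cases "z \<in> S")
    case True
    have fS: "finite S" using S fV finite_subset by blast
    have cS: "card (S - {z}) = h - 1" using True S by simp
    have "{e \<in> E. \<sigma> e = S} = {e \<in> E. \<tau>' e = S - {z}}"
    proof (intro Collect_cong conj_cong refl)
      fix e assume e: "e \<in> E"
      show "\<sigma> e = S \<longleftrightarrow> \<tau>' e = S - {z}"
      proof (cases "card (\<tau>' e) = h")
        case True
        then have "\<tau>' e \<noteq> S - {z}" using cS h by (metis Suc_diff_1 Suc_n_not_le_n le_refl less_le_trans zero_less_one)
        moreover have "\<sigma> e \<noteq> S" using True \<open>z \<in> S\<close> zt[OF e] by (auto simp: \<sigma>_def)
        ultimately show ?thesis by blast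
      next
        case False
        then have "\<sigma> e = insert z (\<tau>' e)" by (simp add: \<sigma>_def)
        then show ?thesis using \<open>z \<in> S\<close> zt[OF e] by (metis Diff_insert_absorb insert_Diff)
      qed
    qed
    moreover have "S - {z} \<subseteq> V - {z}" using S by blast
    ultimately show ?thesis using fib[of "S - {z}"] cS h by simp
  next
    case False
    have "{e \<in> E. \<sigma> e = S} = {e \<in> E. \<tau>' e = S}"
      using False S(2) by (auto simp: \<sigma>_def split: if_splits)
    moreover have "S \<subseteq> V - {z}" using S False by blast
    ultimately show ?thesis using fib[of S] S by simp
  qed
  have colour: "(\<forall>v\<in>V. card {e \<in> E. col e = j \<and> v \<in> \<sigma> e} = r) \<and>
      (\<forall>e\<in>E. \<forall>f\<in>E. col e = j \<and> col f = j \<longrightarrow> (e, f) \<in> linked {e \<in> E. col e = j} \<sigma>)" if j: "j \<in> K" for j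
  proof -
    define F where "F = {e \<in> E. col e = j}"
    have FE: "F \<subseteq> E" by (auto simp: F_def)
    have fF: "finite F" using fE by (simp add: F_def)
    have am1: "\<forall>v\<in>V - {z}. card {e \<in> F. v \<in> \<tau>' e} = r" "(\<Sum>e\<in>F. h - card (\<tau>' e)) = r * 1"
      "\<forall>e\<in>F. \<exists>f. (e, f) \<in> linked F \<tau>' \<and> h - card (\<tau>' f) > 0"
      using am' j unfolding amalgam_def F_def Let_def by blast+
    have "card {e \<in> F. v \<in> \<sigma> e} = r" if v: "v \<in> V" for v
    proof (cases "v = z")
      case True
      have "card {e \<in> F. z \<in> \<sigma> e} = (\<Sum>e\<in>F. if z \<in> \<sigma> e then 1 else 0)"
        using fF by (simp add: sum.If_cases Int_def)
      also have "\<dots> = (\<Sum>e\<in>F. h - card (\<tau>' e))"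
      proof (rule sum.cong)
        fix e assume "e \<in> F"
        then have "e \<in> E" using FE by blast
        then show "(if z \<in> \<sigma> e then 1 else 0) = h - card (\<tau>' e)" using z\<sigma>[of e] w1[of e] by auto
      qed simp
      finally show ?thesis using am1(2) True by simp
    next
      case False
      then have "{e \<in> F. v \<in> \<sigma> e} = {e \<in> F. v \<in> \<tau>' e}" by (auto simp: \<sigma>_def)
      then show ?thesis using am1(1) v False by auto
    qed
    moreover have "(e, f) \<in> linked F \<sigma>" if e: "e \<in> F" and f: "f \<in> F" for e f
    proof -
      have mono: "linked F \<tau>' \<subseteq> linked F \<sigma>" by (rule linked_mono) (auto simp: \<sigma>_def)
      have eq: "equiv F (linked F \<sigma>)" by (rule equiv_linked)
      \<comment> \<open>Every piece still has an end at the amalgamated vertex, hence an edge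
        through \<open>z\<close>; so all pieces are joined at \<open>z\<close>.\<close>
      obtain e' where e': "(e, e') \<in> linked F \<tau>'" "h - card (\<tau>' e') > 0" using am1(3) e by blast
      obtain f' where f': "(f, f') \<in> linked F \<tau>'" "h - card (\<tau>' f') > 0" using am1(3) f by blast
      have F': "e' \<in> F" "f' \<in> F" using e' f' by (auto simp: linked_def)
      then have "e' \<in> E" "f' \<in> E" using FE by auto
      then have "z \<in> \<sigma> e'" "z \<in> \<sigma> f'" using z\<sigma> w1[of e'] w1[of f'] e'(2) f'(2) by fastforce+
      then have "(e', f') \<in> linked F \<sigma>" using F' by (auto intro: linkedI)
      moreover have "(e, e') \<in> linked F \<sigma>" "(f', f) \<in> linked F \<sigma>"
        using e' f' mono eq by (auto simp: equiv_def sym_def)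
      ultimately show ?thesis using eq by (meson equivE transD)
    qed
    ultimately show ?thesis unfolding F_def by auto
  qed
  have "\<forall>e\<in>E. card (\<tau> e) = h \<longrightarrow> \<sigma> e = \<tau> e" using keep by (auto simp: \<sigma>_def)
  moreover have "\<forall>e\<in>E. \<sigma> e \<subseteq> V \<and> card (\<sigma> e) = h" using sub by simp
  moreover have "\<forall>S. S \<subseteq> V \<and> card S = h \<longrightarrow> card {e \<in> E. \<sigma> e = S} = lam" using fibS by simp
  moreover have "\<forall>j\<in>K. (\<forall>v\<in>V. card {e \<in> E. col e = j \<and> v \<in> \<sigma> e} = r) \<and>
      (\<forall>e\<in>E. \<forall>f\<in>E. col e = j \<and> col f = j \<longrightarrow> (e, f) \<in> linked {e \<in> E. col e = j} \<sigma>)"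
    by (rule ballI) (rule colour)
  ultimately show ?thesis by (intro exI[of _ \<sigma>] conjI)
qed

section \<open>Colourings of amalgamated hypergraphs\<close>

lemma sum_card_filter_swap:
  assumes "finite A" "finite B"
  shows "(\<Sum>a\<in>A. card {b \<in> B. P a b}) = (\<Sum>b\<in>B. card {a \<in> A. P a b})"
proof -
  have "card {b \<in> B. P a b} = (\<Sum>b\<in>B. if P a b then 1 else 0)" for a
    using assms by (simp add: sum.If_cases Int_def)
  moreover have "card {a \<in> A. P a b} = (\<Sum>a\<in>A. if P a b then 1 else 0)" for b
    using assms by (simp add: sum.If_cases Int_def)
  ultimately show ?thesis using sum.swap[of "\<lambda>a b. if P a b then 1 else 0::nat" B A] by simp
qed

lemma sum_card_colours:
  assumes "finite F" "finite K" "c ` F \<subseteq> K"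
  shows "(\<Sum>j\<in>K. card {e \<in> F. c e = j \<and> P e}) = card {e \<in> F. P e}"
proof -
  have "(\<Sum>j\<in>K. \<Sum>e | e \<in> {e \<in> F. P e} \<and> c e = j. 1::nat) = (\<Sum>e | e \<in> F \<and> P e. 1)"
    by (rule sum.group) (use assms in auto)
  then show ?thesis by (simp add: conj_ac)
qed

lemma sum_card_vertices:
  assumes "finite F" "finite U" "\<And>e. e \<in> F \<Longrightarrow> \<tau> e \<subseteq> U"
  shows "(\<Sum>v\<in>U. card {e \<in> F. v \<in> \<tau> e}) = (\<Sum>e\<in>F. card (\<tau> e))"
proof -
  have "{v \<in> U. v \<in> \<tau> e} = \<tau> e" if "e \<in> F" for e using assms(3)[OF that] by blast
  then show ?thesis using sum_card_filter_swap[OF assms(2,1), of "\<lambda>v e. v \<in> \<tau> e"] by simp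
qed

lemma greedy_colouring:
  assumes "finite Q" and "finite P" and "P \<inter> Q = {}" and "finite K" and "s \<ge> 1"
    and "c ` P \<subseteq> K" and "\<And>j v. j \<in> K \<Longrightarrow> v \<in> U \<Longrightarrow> card {e \<in> P. c e = j \<and> v \<in> \<tau> e} \<le> r"
    and "\<And>e. e \<in> Q \<Longrightarrow> \<tau> e \<subseteq> U \<and> card (\<tau> e) = s"
    and "\<And>v. v \<in> U \<Longrightarrow> s * (card {e \<in> P \<union> Q. v \<in> \<tau> e} - 1) < r * card K"
  shows "\<exists>d. (\<forall>e\<in>P. d e = c e) \<and> d ` (P \<union> Q) \<subseteq> K \<and>
    (\<forall>j\<in>K. \<forall>v\<in>U. card {e \<in> P \<union> Q. d e = j \<and> v \<in> \<tau> e} \<le> r)"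
  using assms(1,3,8,9)
proof (induction Q rule: finite_induct)
  case empty
  then show ?case using assms(6,7) by (intro exI[of _ c]) auto
next
  case (insert e Q)
  define F where "F = P \<union> Q"
  have fF: "finite F" and eF: "e \<notin> F" using insert assms(2) by (auto simp: F_def)
  have card_F: "card {f \<in> F. v \<in> \<tau> f} \<le> card {f \<in> P \<union> insert e Q. v \<in> \<tau> f}" for v
    using fF by (intro card_mono) (auto simp: F_def)
  have "s * (card {f \<in> P \<union> Q. v \<in> \<tau> f} - 1) < r * card K" if "v \<in> U" for v
    using insert.prems(3)[OF that] card_F[of v] unfolding F_def[symmetric]
    by (meson diff_le_mono le_less_trans mult_le_mono2)
  then obtain d where d: "\<forall>e\<in>P. d e = c e" "d ` F \<subseteq> K"
    "\<forall>j\<in>K. \<forall>v\<in>U. card {f \<in> F. d f = j \<and> v \<in> \<tau> f} \<le> r"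
    using insert.IH insert.prems(1,2) unfolding F_def by auto
  have te: "\<tau> e \<subseteq> U" "card (\<tau> e) = s" using insert.prems(2) by auto
  then have fe: "finite (\<tau> e)" using assms(5) by (metis card.infinite not_one_le_zero)
  have "\<exists>j\<in>K. \<forall>v\<in>\<tau> e. card {f \<in> F. d f = j \<and> v \<in> \<tau> f} < r"
  proof (rule ccontr)
    assume "\<not> ?thesis"
    then have full: "\<exists>v\<in>\<tau> e. card {f \<in> F. d f = j \<and> v \<in> \<tau> f} \<ge> r" if "j \<in> K" for j
      using that by (meson not_le)
    have "r * card K = (\<Sum>j\<in>K. r)" by simp
    also have "\<dots> \<le> (\<Sum>j\<in>K. \<Sum>v\<in>\<tau> e. card {f \<in> F. d f = j \<and> v \<in> \<tau> f})"
    proof (rule sum_mono)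
      fix j assume "j \<in> K"
      then obtain v where "v \<in> \<tau> e" "card {f \<in> F. d f = j \<and> v \<in> \<tau> f} \<ge> r" using full by blast
      then show "r \<le> (\<Sum>v\<in>\<tau> e. card {f \<in> F. d f = j \<and> v \<in> \<tau> f})"
        using fe member_le_sum[of v "\<tau> e" "\<lambda>v. card {f \<in> F. d f = j \<and> v \<in> \<tau> f}"] by simp
    qed
    also have "\<dots> = (\<Sum>v\<in>\<tau> e. card {f \<in> F. v \<in> \<tau> f})"
      by (subst sum.swap) (simp add: sum_card_colours[OF fF assms(4) d(2)])
    finally have "s * (r * card K) \<le> (\<Sum>v\<in>\<tau> e. s * card {f \<in> F. v \<in> \<tau> f})"
      by (simp add: sum_distrib_left[symmetric])
    also have "\<dots> < (\<Sum>v\<in>\<tau> e. r * card K)"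
    proof (rule sum_strict_mono)
      show "\<tau> e \<noteq> {}" using te assms(5) by auto
    next
      fix v assume v: "v \<in> \<tau> e"
      have "{f \<in> P \<union> insert e Q. v \<in> \<tau> f} = insert e {f \<in> F. v \<in> \<tau> f}" using v by (auto simp: F_def)
      then have "card {f \<in> P \<union> insert e Q. v \<in> \<tau> f} - 1 = card {f \<in> F. v \<in> \<tau> f}" using fF eF by simp
      then show "s * card {f \<in> F. v \<in> \<tau> f} < r * card K" using insert.prems(3)[of v] v te by auto
    qed (rule fe)
    finally show False using te by simp
  qed
  then obtain j where j: "j \<in> K" "\<And>v. v \<in> \<tau> e \<Longrightarrow> card {f \<in> F. d f = j \<and> v \<in> \<tau> f} < r" by blast
  have "card {f \<in> insert e F. (d(e := j)) f = i \<and> v \<in> \<tau> f} \<le> r" if iv: "i \<in> K" "v \<in> U" for i v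
  proof (cases "i = j \<and> v \<in> \<tau> e")
    case True
    then have "{f \<in> insert e F. (d(e := j)) f = i \<and> v \<in> \<tau> f} = insert e {f \<in> F. d f = j \<and> v \<in> \<tau> f}"
      using eF by auto
    then show ?thesis using j(2)[of v] True fF eF by simp
  next
    case False
    then have "{f \<in> insert e F. (d(e := j)) f = i \<and> v \<in> \<tau> f} = {f \<in> F. d f = i \<and> v \<in> \<tau> f}"
      using eF by auto
    then show ?thesis using d(3) iv by simp
  qed
  moreover have "P \<union> insert e Q = insert e F" by (auto simp: F_def)
  moreover have "(d(e := j)) ` insert e F \<subseteq> K" using d(2) j(1) by auto
  moreover have "\<forall>f\<in>P. (d(e := j)) f = c f" using d(1) eF by (auto simp: F_def)
  ultimately show ?case by (intro exI[of _ "d(e := j)"]) simp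
qed

lemma colouring_with_class_sizes:
  assumes "finite K" "finite X" "(\<Sum>j\<in>K. g j) = card X"
  shows "\<exists>d. d ` X \<subseteq> K \<and> (\<forall>j\<in>K. card {x \<in> X. d x = j} = g j)"
  using assms
proof (induction K arbitrary: X rule: finite_induct)
  case (insert j K)
  then have "g j \<le> card X" by simp
  then obtain Y where Y: "Y \<subseteq> X" "card Y = g j" by (metis obtain_subset_with_card_n)
  have fY: "finite Y" using Y insert.prems finite_subset by blast
  have "(\<Sum>j\<in>K. g j) = card (X - Y)" using insert Y fY by (simp add: card_Diff_subset)
  then obtain d where d: "d ` (X - Y) \<subseteq> K" "\<forall>i\<in>K. card {x \<in> X - Y. d x = i} = g i"
    using insert.IH[of "X - Y"] insert.prems by auto
  define d' where "d' x = (if x \<in> Y then j else d x)" for x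
  have "{x \<in> X. d' x = j} = Y" using Y d(1) \<open>j \<notin> K\<close> by (auto simp: d'_def)
  moreover have "{x \<in> X. d' x = i} = {x \<in> X - Y. d x = i}" if "i \<in> K" for i
    using that \<open>j \<notin> K\<close> by (auto simp: d'_def)
  moreover have "d' ` X \<subseteq> insert j K" using d(1) by (auto simp: d'_def)
  ultimately show ?case using d(2) Y(2) by (intro exI[of _ d']) auto
qed auto

lemma card_sets_with_trace:
  assumes "finite V" "W \<subseteq> V" "T \<subseteq> W" "card T \<le> h"
  shows "card {S. S \<subseteq> V \<and> card S = h \<and> S \<inter> W = T} = (card V - card W) choose (h - card T)"
proof -
  have fin: "finite W" by (rule finite_subset[OF assms(2,1)])
  then have "finite T" by (rule finite_subset[OF assms(3)])
  note fin = fin this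
  have "bij_betw (\<lambda>R. R \<union> T) {R. R \<subseteq> V - W \<and> card R = h - card T} {S. S \<subseteq> V \<and> card S = h \<and> S \<inter> W = T}"
  proof (rule bij_betw_byWitness[where f' = "\<lambda>S. S - W"])
    show "(\<lambda>R. R \<union> T) ` {R. R \<subseteq> V - W \<and> card R = h - card T} \<subseteq> {S. S \<subseteq> V \<and> card S = h \<and> S \<inter> W = T}"
    proof clarify
      fix R assume R: "R \<subseteq> V - W" "card R = h - card T"
      have "card (R \<union> T) = card R + card T"
        using R assms fin finite_subset[of R V] by (intro card_Un_disjoint) auto
      then show "R \<union> T \<subseteq> V \<and> card (R \<union> T) = h \<and> (R \<union> T) \<inter> W = T" using R assms by auto
    qed
    show "(\<lambda>S. S - W) ` {S. S \<subseteq> V \<and> card S = h \<and> S \<inter> W = T} \<subseteq> {R. R \<subseteq> V - W \<and> card R = h - card T}"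
      using fin by (auto simp: card_Diff_subset_Int)
    show "\<forall>R\<in>{R. R \<subseteq> V - W \<and> card R = h - card T}. R \<union> T - W = R" using assms(3) by fast
    show "\<forall>S\<in>{S. S \<subseteq> V \<and> card S = h \<and> S \<inter> W = T}. S - W \<union> T = S" by auto
  qed
  from bij_betw_same_card[OF this, symmetric]
  have "card {S. S \<subseteq> V \<and> card S = h \<and> S \<inter> W = T} = card {R. R \<subseteq> V - W \<and> card R = h - card T}" .
  also have "\<dots> = card (V - W) choose (h - card T)" using assms by (intro n_subsets) auto
  finally show ?thesis using assms fin by (simp add: card_Diff_subset)
qed

lemma edges_complete: "edges (complete_hypergraph lam h V) = {S. S \<subseteq> V \<and> card S = h} \<times> {..<lam}"
  by (simp add: complete_hypergraph_def)

lemma verts_complete: "verts (complete_hypergraph lam h V) = V"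
  by (simp add: complete_hypergraph_def)

lemma finite_edges_complete: "finite V \<Longrightarrow> finite (edges (complete_hypergraph lam h V))"
  by (simp add: edges_complete)

lemma card_edges_with_trace:
  assumes "finite V" "W \<subseteq> V" "T \<subseteq> W" "card T \<le> h"
  shows "card {e \<in> edges (complete_hypergraph lam h V). fst e \<inter> W = T} =
    lam * ((card V - card W) choose (h - card T))"
proof -
  have "{e \<in> edges (complete_hypergraph lam h V). fst e \<inter> W = T} =
    {S. S \<subseteq> V \<and> card S = h \<and> S \<inter> W = T} \<times> {..<lam}" by (auto simp: edges_complete)
  then show ?thesis using card_sets_with_trace[OF assms] by (simp add: card_cartesian_product)
qed

lemma degree_complete:
  assumes "finite V" "v \<in> V" "h \<ge> 1"
  shows "card {e \<in> edges (complete_hypergraph lam h V). v \<in> fst e} = lam * ((card V - 1) choose (h - 1))"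
proof -
  have "{e \<in> edges (complete_hypergraph lam h V). v \<in> fst e} =
    {e \<in> edges (complete_hypergraph lam h V). fst e \<inter> {v} = {v}}" by auto
  then show ?thesis using card_edges_with_trace[of V "{v}" "{v}" h lam] assms by simp
qed

section \<open>Binomial inequalities for the greedy colouring\<close>

lemma choose_two_real: "2 * real (n choose 2) = real n * (real n - 1)"
  by (induction n) (simp_all add: numeral_2_eq_2 algebra_simps)

lemma choose_three_real: "6 * real (n choose 3) = real n * (real n - 1) * (real n - 2)"
proof (induction n)
  case (Suc n)
  have "6 * real (Suc n choose 3) = 3 * (2 * real (n choose 2)) + 6 * real (n choose 3)"
    by (simp add: numeral_3_eq_3 numeral_2_eq_2)
  then show ?case using Suc unfolding choose_two_real by (simp add: algebra_simps)
qed simp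

text \<open>The constant: \<open>n ^ 3 = 2 * (n - m) ^ 3\<close> holds for \<open>n / m = 1 + 1 / (root 3 2 - 1) = 4.8473221\<dots>\<close>\<close>

lemma choose_bound_pairs:
  fixes n m :: nat
  assumes m: "m > 4" and n: "real n \<ge> 4.847323 * real m"
  shows "(n - 1) choose 3 \<le> 2 * ((n - m) choose 3)"
proof -
  define a where "a = real m"
  define t where "t = real n - real m"
  have a: "a \<ge> 5" using m by (simp add: a_def)
  have nt: "real n = t + a" by (simp add: t_def a_def)
  have n': "1000000 * real n \<ge> 4847323 * real m" using n by (simp add: field_simps)
  then have ta: "1000000 * t \<ge> 3847323 * a" by (simp add: t_def a_def)
  have nm: "n \<ge> m" "n \<ge> 1" using n' m by linarith+
  have t: "real (n - m) = t" "real (n - 1) = t + a - 1" using nm nt by (simp_all add: of_nat_diff t_def a_def)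
  have t0: "t \<ge> 0" using ta a by simp
  \<comment> \<open>The fraction is \<open>C / (C - 1)\<close> for \<open>C = 4.847323\<close> and
    bounds \<open>n / (n - m)\<close>; its cube is just below 2.\<close>
  have "t + a \<le> (4847323 / 3847323) * t" using ta by (simp add: field_simps)
  then have "(t + a) ^ 3 \<le> ((4847323 / 3847323) * t) ^ 3" using t0 a by (intro power_mono) auto
  also have "\<dots> = (4847323 / 3847323) ^ 3 * t ^ 3" by (rule power_mult_distrib)
  also have "\<dots> \<le> 2 * t ^ 3" using t0 by (intro mult_right_mono) (simp_all add: power3_eq_cube)
  finally have cube: "(t + a) ^ 3 \<le> 2 * t ^ 3" .
  have "a * t \<ge> 5 * t" "a * a \<ge> 5 * a" using a t0 by (simp_all add: mult_right_mono)
  \<comment> \<open>In the difference of the two products the terms \<open>t ^ 2\<close> cancel, and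
    the remaining lower-order terms are nonnegative. So the comparison of cubes decides.\<close>
  then have "12 * (a * t) + 6 * (a * a) - 11 * a - 7 * t + 6 \<ge> 0" using a t0 by linarith
  moreover have "2 * (t * (t - 1) * (t - 2)) - (t + a - 1) * (t + a - 2) * (t + a - 3) =
    (2 * t ^ 3 - (t + a) ^ 3) + (12 * (a * t) + 6 * (a * a) - 11 * a - 7 * t + 6)"
    by (simp add: algebra_simps power3_eq_cube)
  ultimately have "(t + a - 1) * (t + a - 2) * (t + a - 3) \<le> 2 * (t * (t - 1) * (t - 2))" using cube by linarith
  then have "6 * real ((n - 1) choose 3) \<le> 2 * (6 * real ((n - m) choose 3))"
    unfolding choose_three_real t by (simp add: algebra_simps)
  then show ?thesis by linarith
qed

text \<open>Up to the factor \<open>lam\<close>, the edges through a vertex of \<open>W\<close> with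
  at least three vertices in \<open>W\<close> number \<open>(n - 1) choose 3\<close> less those with
  one and those with two. The inequality says that three times this is at most
  \<open>(n - 1) choose 3\<close>.\<close>

lemma choose_bound_triples:
  fixes n m :: nat
  assumes m: "m > 4" and n: "n \<ge> 4 * m"
  shows "2 * ((n - 1) choose 3) \<le> 3 * ((n - m) choose 3) + 3 * ((m - 1) * ((n - m) choose 2))"
proof -
  \<comment> \<open>In terms of \<open>m = b + 5\<close> and \<open>n = 4 * m + s\<close>, the
    difference of the two sides is, up to a factor, a polynomial in \<open>b\<close> and
    \<open>s\<close> with nonnegative coefficients only.\<close>
  define b where "b = real m - 5"
  define s where "s = real n - 4 * real m"
  have b: "b \<ge> 0" "s \<ge> 0" using m n by (simp_all add: b_def s_def)
  have t: "real (n - m) = 3 * b + 15 + s" "real (n - 1) = 4 * b + 19 + s" "real (m - 1) = b + 4"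
    using m n by (simp_all add: of_nat_diff b_def s_def)
  have "0 \<le> b * b * b" "0 \<le> b * b * s" "0 \<le> b * s * s" "0 \<le> s * s * s" "0 \<le> b * b" "0 \<le> b * s" "0 \<le> s * s"
    using b by simp_all
  then have "2 * ((4 * b + 19 + s) * (4 * b + 19 + s - 1) * (4 * b + 19 + s - 2)) \<le>
    3 * ((3 * b + 15 + s) * (3 * b + 15 + s - 1) * (3 * b + 15 + s - 2)) +
    9 * ((b + 4) * ((3 * b + 15 + s) * (3 * b + 15 + s - 1)))"
    using b by (simp add: algebra_simps)
  then have "2 * (6 * real ((n - 1) choose 3)) \<le>
    3 * (6 * real ((n - m) choose 3)) + 9 * (real (m - 1) * (2 * real ((n - m) choose 2)))"
    unfolding choose_three_real choose_two_real t .
  then have "real (2 * ((n - 1) choose 3)) \<le> real (3 * ((n - m) choose 3) + 3 * ((m - 1) * ((n - m) choose 2)))"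
    by simp
  then show ?thesis by linarith
qed

text \<open>Edges with three and then two vertices in \<open>W\<close> are coloured greedily. The edges with one vertex
  in \<open>W\<close> can then complete the degrees in \<open>W\<close>, and those disjoint from \<open>W\<close> the class sizes.\<close>

lemma extend_colouring:
  fixes c :: "'a hyperedge \<Rightarrow> 'k" and V W :: "'a set" and lam r n m :: nat
  defines "E \<equiv> edges (complete_hypergraph lam 4 V)"
  assumes fV: "finite V" and WV: "W \<subseteq> V" and n: "card V = n" and m: "card W = m"
    and m4: "m > 4" and nm: "real n \<ge> 4.847323 * real m" and lam: "lam > 0"
    and fK: "finite K" and rn: "4 dvd r * n" and rK: "r * card K = lam * ((n - 1) choose 3)"
    and cK: "\<And>e. e \<in> E \<Longrightarrow> fst e \<subseteq> W \<Longrightarrow> c e \<in> K"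
    and deg: "\<And>j v. j \<in> K \<Longrightarrow> v \<in> W \<Longrightarrow> card {e \<in> E. fst e \<subseteq> W \<and> c e = j \<and> v \<in> fst e} \<le> r"
  shows "\<exists>col. (\<forall>e\<in>E. fst e \<subseteq> W \<longrightarrow> col e = c e) \<and> col ` E \<subseteq> K \<and>
    (\<forall>j\<in>K. (\<forall>v\<in>W. card {e \<in> E. col e = j \<and> v \<in> fst e} = r) \<and> 4 * card {e \<in> E. col e = j} = r * n)"
proof -
  have n4m: "n \<ge> 4 * m"
  proof -
    have "1000000 * real n \<ge> 4847323 * real m" using nm by (simp add: field_simps)
    then have "real n \<ge> 4 * real m" by linarith
    then show ?thesis by linarith
  qed
  have fW: "finite W" by (rule finite_subset[OF WV fV])
  have fE: "finite E" unfolding E_def by (rule finite_edges_complete[OF fV])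
  define \<tau> where "\<tau> e = fst e \<inter> W" for e :: "'a hyperedge"
  define P where "P i = {e \<in> E. card (\<tau> e) \<ge> i}" for i
  have fP: "finite (P i)" for i using fE by (simp add: P_def)
  have tW: "\<tau> e \<subseteq> W" "finite (\<tau> e)" for e using fW by (auto simp: \<tau>_def)
  have c4: "card (fst e) = 4" "finite (fst e)" if "e \<in> E" for e
    using that by (auto simp: E_def edges_complete intro: card_ge_0_finite)
  have ct4: "card (\<tau> e) \<le> 4" if "e \<in> E" for e
    using card_mono[OF c4(2)[OF that], of "\<tau> e"] c4(1)[OF that] by (auto simp: \<tau>_def)
  have inW: "fst e \<subseteq> W \<longleftrightarrow> card (\<tau> e) = 4" if "e \<in> E" for e
  proof
    assume "fst e \<subseteq> W"
    then show "card (\<tau> e) = 4" using c4[OF that] by (simp add: \<tau>_def Int_absorb2)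
  next
    assume "card (\<tau> e) = 4"
    then have "\<tau> e = fst e" using c4[OF that] by (intro card_subset_eq) (auto simp: \<tau>_def)
    then show "fst e \<subseteq> W" by (auto simp: \<tau>_def)
  qed
  have fib: "card {e \<in> E. \<tau> e = T} = lam * ((n - m) choose (4 - card T))" if "T \<subseteq> W" "card T \<le> 4" for T
    unfolding E_def \<tau>_def using card_edges_with_trace[OF fV WV that] n m by simp
  have degE: "card {e \<in> E. v \<in> \<tau> e} = lam * ((n - 1) choose 3)" if "v \<in> W" for v
    using degree_complete[of V v 4 lam] that WV fV n by (auto simp: E_def \<tau>_def)
  have deg1: "card {e \<in> E. \<tau> e = {v}} = lam * ((n - m) choose 3)" if "v \<in> W" for v
    using fib[of "{v}"] that by simp
  have one: "card (\<tau> e) = 1 \<and> v \<in> \<tau> e \<longleftrightarrow> \<tau> e = {v}" for e v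
    by (auto simp: card_1_singleton_iff)
  have deg2: "card {e \<in> E. card (\<tau> e) = 2 \<and> v \<in> \<tau> e} = (m - 1) * (lam * ((n - m) choose 2))" if v: "v \<in> W" for v
  proof -
    have "{e \<in> E. card (\<tau> e) = 2 \<and> v \<in> \<tau> e} = (\<Union>u\<in>W - {v}. {e \<in> E. \<tau> e = {u, v}})"
    proof (intro set_eqI iffI)
      fix e assume "e \<in> {e \<in> E. card (\<tau> e) = 2 \<and> v \<in> \<tau> e}"
      then have e: "e \<in> E" "card (\<tau> e) = 2" "v \<in> \<tau> e" by auto
      then obtain a b where "\<tau> e = {a, b}" "a \<noteq> b" by (metis card_2_iff)
      then obtain u where "\<tau> e = {u, v}" "u \<noteq> v" using e(3) by (metis insertE insert_commute singletonD)
      then show "e \<in> (\<Union>u\<in>W - {v}. {e \<in> E. \<tau> e = {u, v}})" using e tW(1)[of e] by auto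
    qed auto
    also have "card \<dots> = (\<Sum>u\<in>W - {v}. card {e \<in> E. \<tau> e = {u, v}})"
      using fW fE by (intro card_UN_disjoint) (auto simp: doubleton_eq_iff)
    also have "\<dots> = (\<Sum>u\<in>W - {v}. lam * ((n - m) choose 2))"
    proof (rule sum.cong)
      fix u assume "u \<in> W - {v}"
      then show "card {e \<in> E. \<tau> e = {u, v}} = lam * ((n - m) choose 2)" using fib[of "{u, v}"] v by auto
    qed simp
    finally show ?thesis using v fW m by simp
  qed
  have D2: "card {e \<in> P 2. v \<in> \<tau> e} + lam * ((n - m) choose 3) = lam * ((n - 1) choose 3)" if v: "v \<in> W" for v
  proof -
    have "{e \<in> E. v \<in> \<tau> e} = {e \<in> P 2. v \<in> \<tau> e} \<union> {e \<in> E. \<tau> e = {v}}"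
    proof -
      have cases: "card (\<tau> e) \<ge> 2 \<or> card (\<tau> e) = 1" if "v \<in> \<tau> e" for e
      proof -
        have "card (\<tau> e) > 0" using that tW(2)[of e] card_gt_0_iff by blast
        then show ?thesis by linarith
      qed
      show ?thesis unfolding one[symmetric] P_def using cases by blast
    qed
    moreover have "{e \<in> P 2. v \<in> \<tau> e} \<inter> {e \<in> E. \<tau> e = {v}} = {}" by (auto simp: P_def)
    ultimately show ?thesis using degE[OF v] deg1[OF v] fP fE by (simp add: card_Un_disjoint)
  qed
  have D3: "card {e \<in> P 3. v \<in> \<tau> e} + (m - 1) * (lam * ((n - m) choose 2)) = card {e \<in> P 2. v \<in> \<tau> e}"
    if v: "v \<in> W" for v
  proof -
    have "{e \<in> P 2. v \<in> \<tau> e} = {e \<in> P 3. v \<in> \<tau> e} \<union> {e \<in> E. card (\<tau> e) = 2 \<and> v \<in> \<tau> e}"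
      by (auto simp: P_def)
    moreover have "{e \<in> P 3. v \<in> \<tau> e} \<inter> {e \<in> E. card (\<tau> e) = 2 \<and> v \<in> \<tau> e} = {}" by (auto simp: P_def)
    ultimately show ?thesis using deg2[OF v] fP fE by (simp add: card_Un_disjoint)
  qed
  have "n - 1 \<ge> 3" using n4m m4 by linarith
  then have rK0: "r * card K > 0" using rK lam by simp
  have b2: "2 * card {e \<in> P 2. v \<in> \<tau> e} \<le> r * card K" if v: "v \<in> W" for v
  proof -
    have "lam * ((n - 1) choose 3) \<le> lam * (2 * ((n - m) choose 3))"
      using choose_bound_pairs[OF m4 nm] by (rule mult_le_mono2)
    also have "\<dots> = 2 * (lam * ((n - m) choose 3))" by (rule mult.left_commute)
    finally show ?thesis using D2[OF v] rK by linarith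
  qed
  have b3: "3 * card {e \<in> P 3. v \<in> \<tau> e} \<le> r * card K" if v: "v \<in> W" for v
  proof -
    have "lam * (2 * ((n - 1) choose 3)) \<le> lam * (3 * ((n - m) choose 3) + 3 * ((m - 1) * ((n - m) choose 2)))"
      using choose_bound_triples[OF m4 n4m] by (rule mult_le_mono2)
    then have "2 * (lam * ((n - 1) choose 3)) \<le>
        3 * (lam * ((n - m) choose 3)) + 3 * (lam * ((m - 1) * ((n - m) choose 2)))"
      by (simp only: distrib_left mult.left_commute[of lam])
    moreover have "card {e \<in> P 3. v \<in> \<tau> e} + lam * ((m - 1) * ((n - m) choose 2)) + lam * ((n - m) choose 3) = r * card K"
      using D2[OF v] D3[OF v] rK by (simp only: mult.left_commute[of lam])
    ultimately show ?thesis using rK by linarith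
  qed
  \<comment> \<open>The bounds \<open>b2\<close> and \<open>b3\<close> are not strict; strictness
    comes from not counting the edge being coloured, and for \<open>D = 0\<close> from
    \<open>rK0\<close>.\<close>
  have strict: "s * (D - 1) < r * card K" if "s * D \<le> r * card K" "s \<ge> 1" for s D
    using that rK0 by (cases D) auto
  have P4: "P 4 = {e \<in> E. fst e \<subseteq> W}" using inW ct4 by (force simp: P_def)
  have c4deg: "card {e \<in> P 4. c e = j \<and> v \<in> \<tau> e} \<le> r" if "j \<in> K" "v \<in> W" for j v
  proof -
    have "{e \<in> P 4. c e = j \<and> v \<in> \<tau> e} = {e \<in> E. fst e \<subseteq> W \<and> c e = j \<and> v \<in> fst e}"
      using that by (auto simp: P4 \<tau>_def)
    then show ?thesis using deg[OF that] by simp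
  qed
  have split: "P i = P (Suc i) \<union> {e \<in> E. card (\<tau> e) = i}" "P (Suc i) \<inter> {e \<in> E. card (\<tau> e) = i} = {}" for i
    by (auto simp: P_def)
  have "\<exists>d. (\<forall>e\<in>P 4. d e = c e) \<and> d ` (P 4 \<union> {e \<in> E. card (\<tau> e) = 3}) \<subseteq> K \<and>
      (\<forall>j\<in>K. \<forall>v\<in>W. card {e \<in> P 4 \<union> {e \<in> E. card (\<tau> e) = 3}. d e = j \<and> v \<in> \<tau> e} \<le> r)"
  proof (rule greedy_colouring[where s = 3])
    show "c ` P 4 \<subseteq> K" using cK by (auto simp: P4)
    show "3 * (card {e \<in> P 4 \<union> {e \<in> E. card (\<tau> e) = 3}. v \<in> \<tau> e} - 1) < r * card K" if "v \<in> W" for v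
      using strict[OF b3[OF that]] split(1)[of 3] by simp
    show "P 4 \<inter> {e \<in> E. card (\<tau> e) = 3} = {}" using split(2)[of 3] by simp
  qed (use fE fP fK c4deg tW in auto)
  then obtain d3 where d3: "\<forall>e\<in>P 4. d3 e = c e" "d3 ` P 3 \<subseteq> K"
    "\<forall>j\<in>K. \<forall>v\<in>W. card {e \<in> P 3. d3 e = j \<and> v \<in> \<tau> e} \<le> r"
    using split(1)[of 3] by auto
  have "\<exists>d. (\<forall>e\<in>P 3. d e = d3 e) \<and> d ` (P 3 \<union> {e \<in> E. card (\<tau> e) = 2}) \<subseteq> K \<and>
      (\<forall>j\<in>K. \<forall>v\<in>W. card {e \<in> P 3 \<union> {e \<in> E. card (\<tau> e) = 2}. d e = j \<and> v \<in> \<tau> e} \<le> r)"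
  proof (rule greedy_colouring[where s = 2])
    show "2 * (card {e \<in> P 3 \<union> {e \<in> E. card (\<tau> e) = 2}. v \<in> \<tau> e} - 1) < r * card K" if "v \<in> W" for v
      using strict[OF b2[OF that]] split(1)[of 2] by simp
    show "P 3 \<inter> {e \<in> E. card (\<tau> e) = 2} = {}" using split(2)[of 2] by simp
  qed (use fE fP fK d3 tW in auto)
  then obtain d2 where d2: "\<forall>e\<in>P 3. d2 e = d3 e" "d2 ` P 2 \<subseteq> K"
    "\<forall>j\<in>K. \<forall>v\<in>W. card {e \<in> P 2. d2 e = j \<and> v \<in> \<tau> e} \<le> r"
    using split(1)[of 2] by auto
  \<comment> \<open>Edges whose trace on \<open>W\<close> is \<open>{v}\<close> affect no other
    degree in \<open>W\<close>, so each vertex is completed on its own. The deficits at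
    \<open>v\<close> over all colours add up exactly to the number of these edges.\<close>
  have "\<exists>f. f ` {e \<in> E. \<tau> e = {v}} \<subseteq> K \<and>
     (\<forall>j\<in>K. card {e \<in> {e \<in> E. \<tau> e = {v}}. f e = j} = r - card {e \<in> P 2. d2 e = j \<and> v \<in> \<tau> e})"
    if v: "v \<in> W" for v
  proof (rule colouring_with_class_sizes[OF fK])
    have "(\<Sum>j\<in>K. r - card {e \<in> P 2. d2 e = j \<and> v \<in> \<tau> e}) + (\<Sum>j\<in>K. card {e \<in> P 2. d2 e = j \<and> v \<in> \<tau> e}) = r * card K"
      unfolding sum.distrib[symmetric] using d2(3) v by simp
    then show "(\<Sum>j\<in>K. r - card {e \<in> P 2. d2 e = j \<and> v \<in> \<tau> e}) = card {e \<in> E. \<tau> e = {v}}"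
      using D2[OF v] deg1[OF v] rK sum_card_colours[OF fP fK d2(2), of "\<lambda>e. v \<in> \<tau> e"] by simp
  qed (use fE in simp)
  then have "\<forall>v\<in>W. \<exists>f. f ` {e \<in> E. \<tau> e = {v}} \<subseteq> K \<and>
     (\<forall>j\<in>K. card {e \<in> {e \<in> E. \<tau> e = {v}}. f e = j} = r - card {e \<in> P 2. d2 e = j \<and> v \<in> \<tau> e})"
    by (rule ballI)
  from bchoice[OF this] obtain f where f: "\<And>v. v \<in> W \<Longrightarrow> f v ` {e \<in> E. \<tau> e = {v}} \<subseteq> K"
     "\<And>v j. v \<in> W \<Longrightarrow> j \<in> K \<Longrightarrow>
        card {e \<in> {e \<in> E. \<tau> e = {v}}. f v e = j} = r - card {e \<in> P 2. d2 e = j \<and> v \<in> \<tau> e}"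
    by fast
  define d1 where "d1 e = (if card (\<tau> e) \<ge> 2 then d2 e else f (the_elem (\<tau> e)) e)" for e
  have P1: "\<tau> e \<noteq> {} \<longleftrightarrow> card (\<tau> e) \<ge> 1" for e using tW(2)[of e] by (simp add: Suc_le_eq card_gt_0_iff)
  have d1deg: "card {e \<in> P 1. d1 e = j \<and> v \<in> \<tau> e} = r" if j: "j \<in> K" and v: "v \<in> W" for j v
  proof -
    have "{e \<in> P 1. d1 e = j \<and> v \<in> \<tau> e} = {e \<in> P 2. d2 e = j \<and> v \<in> \<tau> e} \<union> {e \<in> {e \<in> E. \<tau> e = {v}}. f v e = j}"
    proof (intro set_eqI iffI)
      fix e assume "e \<in> {e \<in> P 1. d1 e = j \<and> v \<in> \<tau> e}"
      then have e: "e \<in> E" "card (\<tau> e) \<ge> 1" "d1 e = j" "v \<in> \<tau> e" by (auto simp: P_def)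
      show "e \<in> {e \<in> P 2. d2 e = j \<and> v \<in> \<tau> e} \<union> {e \<in> {e \<in> E. \<tau> e = {v}}. f v e = j}"
      proof (cases "card (\<tau> e) \<ge> 2")
        case True
        then show ?thesis using e by (simp add: d1_def P_def)
      next
        case False
        then have "\<tau> e = {v}" using e one[of e v] by simp
        then show ?thesis using e False by (simp add: d1_def)
      qed
    qed (auto simp: P_def d1_def)
    moreover have "{e \<in> P 2. d2 e = j \<and> v \<in> \<tau> e} \<inter> {e \<in> {e \<in> E. \<tau> e = {v}}. f v e = j} = {}"
      by (auto simp: P_def)
    moreover have "finite {e \<in> P 2. d2 e = j \<and> v \<in> \<tau> e}" "finite {e \<in> {e \<in> E. \<tau> e = {v}}. f v e = j}"
      using fP fE by auto
    ultimately have "card {e \<in> P 1. d1 e = j \<and> v \<in> \<tau> e} =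
      card {e \<in> P 2. d2 e = j \<and> v \<in> \<tau> e} + card {e \<in> {e \<in> E. \<tau> e = {v}}. f v e = j}"
      by (simp only: card_Un_disjoint)
    then show ?thesis using f(2)[OF v j] d2(3) j v by simp
  qed
  have d1K: "d1 ` P 1 \<subseteq> K"
  proof
    fix k assume "k \<in> d1 ` P 1"
    then obtain e where e: "e \<in> E" "card (\<tau> e) \<ge> 1" "k = d1 e" by (auto simp: P_def)
    show "k \<in> K"
    proof (cases "card (\<tau> e) \<ge> 2")
      case True
      then show ?thesis using e d2(2) by (auto simp: d1_def P_def)
    next
      case False
      then have "card (\<tau> e) = 1" using e by simp
      then obtain v where v: "\<tau> e = {v}" by (auto simp: card_1_singleton_iff)
      then have "v \<in> W" using tW(1)[of e] by auto
      then show ?thesis using f(1)[of v] v e False by (auto simp: d1_def)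
    qed
  qed
  \<comment> \<open>Every edge of \<open>P 1\<close> uses up at least one of the
    \<open>r * m\<close> incidences of its class with \<open>W\<close>, and
    \<open>4 * m \<le> n\<close>. So no class is too large before the edges disjoint from
    \<open>W\<close> are added.\<close>
  have few: "4 * card {e \<in> P 1. d1 e = j} \<le> r * n" if j: "j \<in> K" for j
  proof -
    have "card {e \<in> P 1. d1 e = j} = (\<Sum>e | e \<in> P 1 \<and> d1 e = j. 1)" by simp
    also have "\<dots> \<le> (\<Sum>e | e \<in> P 1 \<and> d1 e = j. card (\<tau> e))"
      by (rule sum_mono) (simp add: P_def)
    also have "\<dots> = (\<Sum>v\<in>W. card {e \<in> {e \<in> P 1. d1 e = j}. v \<in> \<tau> e})"
      using fP fW tW by (intro sum_card_vertices[symmetric]) auto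
    also have "\<dots> = r * m" using d1deg[OF j] m by simp
    finally have "4 * card {e \<in> P 1. d1 e = j} \<le> r * (4 * m)" by simp
    also have "\<dots> \<le> r * n" using n4m by (rule mult_le_mono2)
    finally show ?thesis .
  qed
  \<comment> \<open>The missing class sizes add up to the number of edges disjoint from
    \<open>W\<close>, since \<open>card K\<close> classes of \<open>r * n div 4\<close> edges make
    up all \<open>lam * (n choose 4)\<close> edges.\<close>
  have "\<exists>d. d ` {e \<in> E. \<tau> e = {}} \<subseteq> K \<and>
    (\<forall>j\<in>K. card {e \<in> {e \<in> E. \<tau> e = {}}. d e = j} = r * n div 4 - card {e \<in> P 1. d1 e = j})"
  proof (rule colouring_with_class_sizes[OF fK])
    have "r * n div 4 - card {e \<in> P 1. d1 e = j} + card {e \<in> P 1. d1 e = j} = r * n div 4" if "j \<in> K" for j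
      using few[OF that] by linarith
    then have "(\<Sum>j\<in>K. r * n div 4 - card {e \<in> P 1. d1 e = j}) + (\<Sum>j\<in>K. card {e \<in> P 1. d1 e = j}) = card K * (r * n div 4)"
      unfolding sum.distrib[symmetric] by simp
    moreover have "(\<Sum>j\<in>K. card {e \<in> P 1. d1 e = j}) = card (P 1)"
      using sum_card_colours[OF fP fK d1K, of "\<lambda>_. True"] by simp
    moreover have "card K * (r * n div 4) = card E"
    proof -
      have "4 * (card K * (r * n div 4)) = n * (r * card K)" using rn by (auto simp: dvd_def)
      also have "\<dots> = lam * (n * ((n - 1) choose 3))" unfolding rK by simp
      also have "n * ((n - 1) choose 3) = 4 * (n choose 4)"
        using times_binomial_minus1_eq[of 4 n] by simp
      finally have "card K * (r * n div 4) = lam * (n choose 4)" by simp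
      moreover have "card E = lam * (n choose 4)"
        using n_subsets[OF fV, of 4] n by (simp add: E_def edges_complete card_cartesian_product)
      ultimately show ?thesis by simp
    qed
    moreover have "card E = card (P 1) + card {e \<in> E. \<tau> e = {}}"
    proof -
      have "E = P 1 \<union> {e \<in> E. \<tau> e = {}}" "P 1 \<inter> {e \<in> E. \<tau> e = {}} = {}" using P1 by (auto simp: P_def)
      then show ?thesis using card_Un_disjoint[of "P 1" "{e \<in> E. \<tau> e = {}}"] fP fE by simp
    qed
    ultimately show "(\<Sum>j\<in>K. r * n div 4 - card {e \<in> P 1. d1 e = j}) = card {e \<in> E. \<tau> e = {}}" by simp
  qed (use fE in simp)
  then obtain d0 where d0: "d0 ` {e \<in> E. \<tau> e = {}} \<subseteq> K"
    "\<And>j. j \<in> K \<Longrightarrow> card {e \<in> {e \<in> E. \<tau> e = {}}. d0 e = j} = r * n div 4 - card {e \<in> P 1. d1 e = j}"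
    by blast
  define col where "col e = (if \<tau> e = {} then d0 e else d1 e)" for e
  have "col e = c e" if "e \<in> E" "fst e \<subseteq> W" for e
  proof -
    have "card (\<tau> e) = 4" using inW that by simp
    then have "\<tau> e \<noteq> {}" "e \<in> P 4" "e \<in> P 3" using that by (auto simp: P_def)
    then show ?thesis using d2(1) d3(1) \<open>card (\<tau> e) = 4\<close> by (simp add: col_def d1_def)
  qed
  moreover have "col ` E \<subseteq> K"
  proof
    fix k assume "k \<in> col ` E"
    then obtain e where e: "e \<in> E" "k = col e" by blast
    show "k \<in> K"
    proof (cases "\<tau> e = {}")
      case True
      then show ?thesis using e d0(1) by (auto simp: col_def)
    next
      case False
      then have "e \<in> P 1" using e P1 by (simp add: P_def)
      then show ?thesis using e False d1K by (auto simp: col_def)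
    qed
  qed
  moreover have "card {e \<in> E. col e = j \<and> v \<in> fst e} = r" if "j \<in> K" "v \<in> W" for j v
  proof -
    have "{e \<in> E. col e = j \<and> v \<in> fst e} = {e \<in> P 1. d1 e = j \<and> v \<in> \<tau> e}"
    proof (rule Collect_cong)
      fix e
      have "v \<in> fst e \<longleftrightarrow> v \<in> \<tau> e" using that by (simp add: \<tau>_def)
      moreover have "card (\<tau> e) \<ge> 1 \<and> \<tau> e \<noteq> {}" if "v \<in> \<tau> e" using that P1 by blast
      ultimately show "e \<in> E \<and> col e = j \<and> v \<in> fst e \<longleftrightarrow> e \<in> P 1 \<and> d1 e = j \<and> v \<in> \<tau> e"
        by (auto simp: P_def col_def)
    qed
    then show ?thesis using d1deg[OF that] by simp
  qed
  moreover have "4 * card {e \<in> E. col e = j} = r * n" if j: "j \<in> K" for j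
  proof -
    have "{e \<in> E. col e = j} = {e \<in> P 1. d1 e = j} \<union> {e \<in> {e \<in> E. \<tau> e = {}}. d0 e = j}"
      using P1 by (auto simp: P_def col_def split: if_splits)
    moreover have "{e \<in> P 1. d1 e = j} \<inter> {e \<in> {e \<in> E. \<tau> e = {}}. d0 e = j} = {}"
      using P1 by (auto simp: P_def)
    moreover have "finite {e \<in> P 1. d1 e = j}" "finite {e \<in> {e \<in> E. \<tau> e = {}}. d0 e = j}"
      using fP fE by auto
    ultimately have "card {e \<in> E. col e = j} = card {e \<in> P 1. d1 e = j} + card {e \<in> {e \<in> E. \<tau> e = {}}. d0 e = j}"
      by (simp only: card_Un_disjoint)
    then show ?thesis using d0(2)[OF j] few[OF j] rn by auto
  qed
  ultimately show ?thesis by (intro exI[of _ col]) simp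
qed

section \<open>Components of colour classes and the initial amalgam\<close>

lemma edges_color_class: "edges (color_class H c i) = {e \<in> edges H. c e = i}"
  by (simp add: color_class_def)

lemma verts_color_class: "verts (color_class H c i) = verts H"
  by (simp add: color_class_def)

lemma edges_complete_within:
  assumes "W \<subseteq> V"
  shows "edges (complete_hypergraph lam h W) = {e \<in> edges (complete_hypergraph lam h V). fst e \<subseteq> W}"
  using assms by (auto simp: edges_complete)

lemma component_in_components: "u \<in> verts H \<Longrightarrow> induced H {v \<in> verts H. reachable H u v} \<in> components H"
  unfolding components_def by blast

lemma reachable_step: "reachable H u v \<Longrightarrow> e \<in> edges H \<Longrightarrow> v \<in> fst e \<Longrightarrow> w \<in> fst e \<Longrightarrow> reachable H u w"
  unfolding reachable_def by (rule rtranclp.rtrancl_into_rtrancl) (auto simp: adjacent_def)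

lemma reachable_induct [consumes 1, case_names base step]:
  assumes "reachable H u v" "P u"
    "\<And>v w e. P v \<Longrightarrow> e \<in> edges H \<Longrightarrow> v \<in> fst e \<Longrightarrow> w \<in> fst e \<Longrightarrow> P w"
  shows "P v"
  using assms(1) unfolding reachable_def
proof (induction rule: rtranclp_induct)
  case (step v w)
  then show ?case using assms(3) unfolding adjacent_def by blast
qed (rule assms(2))

lemma degree_component:
  assumes "reachable H u v" "\<And>e. e \<in> edges H \<Longrightarrow> fst e \<subseteq> verts H"
  shows "degree (induced H {v \<in> verts H. reachable H u v}) v = degree H v"
proof -
  have "fst e \<subseteq> {v \<in> verts H. reachable H u v}" if "e \<in> edges H" "v \<in> fst e" for e
    using that assms reachable_step by fastforce
  then have "{e \<in> edges (induced H {v \<in> verts H. reachable H u v}). v \<in> fst e} = {e \<in> edges H. v \<in> fst e}"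
    unfolding induced_def by auto
  then show ?thesis unfolding degree_def by simp
qed

text \<open>Suppose that all edges linked to \<open>e\<close> lie in \<open>W\<close>. Each vertex
  on them then has all its \<open>r\<close> edges of the class inside \<open>W\<close>, so these
  vertices form an \<open>r\<close>-regular component of the class within \<open>W\<close>, which is
  excluded by \<open>irr\<close>.\<close>

lemma classes_reach_outside:
  fixes col c :: "'a hyperedge \<Rightarrow> nat"
  assumes WV: "W \<subseteq> V" and h: "h \<ge> 1"
    and F: "F = {e \<in> edges (complete_hypergraph lam h V). col e = j}"
    and agree: "\<And>e. e \<in> edges (complete_hypergraph lam h V) \<Longrightarrow> fst e \<subseteq> W \<Longrightarrow> col e = c e"
    and deg: "\<And>v. v \<in> W \<Longrightarrow> card {e \<in> F. v \<in> fst e} = r"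
    and irr: "\<And>C. C \<in> components (color_class (complete_hypergraph lam h W) c j) \<Longrightarrow> \<not> regular r C"
    and eF: "e \<in> F"
  shows "\<exists>f. (e, f) \<in> linked F (\<lambda>e. fst e \<inter> W) \<and> \<not> fst f \<subseteq> W"
proof (rule ccontr)
  assume "\<not> ?thesis"
  then have inside: "fst f \<subseteq> W" if "(e, f) \<in> linked F (\<lambda>e. fst e \<inter> W)" for f using that by blast
  define H where "H = color_class (complete_hypergraph lam h W) c j"
  have vH: "verts H = W" by (simp add: H_def verts_color_class verts_complete)
  have eH: "edges H = {f \<in> F. fst f \<subseteq> W}"
    unfolding H_def edges_color_class edges_complete_within[OF WV] F using agree by auto
  have eq: "equiv F (linked F (\<lambda>e. fst e \<inter> W))" by (rule equiv_linked)
  have ee: "(e, e) \<in> linked F (\<lambda>e. fst e \<inter> W)" using eF by (rule equiv_class_self[OF eq, simplified])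
  have "fst e \<noteq> {}" using eF h by (auto simp: F edges_complete)
  then obtain u where u: "u \<in> fst e" by blast
  have uW: "u \<in> W" using u inside[OF ee] by blast
  have near: "v \<in> W \<and> (\<exists>f. (e, f) \<in> linked F (\<lambda>e. fst e \<inter> W) \<and> v \<in> fst f)" if "reachable H u v" for v
    using that
  proof (induction rule: reachable_induct)
    case base
    show ?case using ee u uW by blast
  next
    case (step v w g)
    then obtain f where f: "(e, f) \<in> linked F (\<lambda>e. fst e \<inter> W)" "v \<in> fst f" "v \<in> W" by blast
    have g: "g \<in> F" "fst g \<subseteq> W" using step by (auto simp: eH)
    have "f \<in> F" using f by (auto simp: linked_def)
    then have "(f, g) \<in> linked F (\<lambda>e. fst e \<inter> W)" using f g step by (auto intro: linkedI)
    then have "(e, g) \<in> linked F (\<lambda>e. fst e \<inter> W)" using f eq by (meson equivE transD)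
    then show ?case using g step by blast
  qed
  \<comment> \<open>Any edge of the class at a vertex \<open>v\<close> reached from \<open>u\<close>
    is linked to \<open>e\<close> through \<open>v\<close>, hence lies in \<open>W\<close>: the
    degree of \<open>v\<close> in \<open>H\<close> is its full degree \<open>r\<close>.\<close>
  have "degree H v = r" if uv: "reachable H u v" for v
  proof -
    obtain f where f: "(e, f) \<in> linked F (\<lambda>e. fst e \<inter> W)" "v \<in> fst f" "v \<in> W" using near[OF uv] by blast
    have "fst g \<subseteq> W" if "g \<in> F" "v \<in> fst g" for g
    proof -
      have "f \<in> F" using f by (auto simp: linked_def)
      then have "(f, g) \<in> linked F (\<lambda>e. fst e \<inter> W)" using f that by (auto intro: linkedI)
      then have "(e, g) \<in> linked F (\<lambda>e. fst e \<inter> W)" using f eq by (meson equivE transD)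
      then show ?thesis by (rule inside)
    qed
    then have "{g \<in> edges H. v \<in> fst g} = {g \<in> F. v \<in> fst g}" by (auto simp: eH)
    then show ?thesis using deg[OF f(3)] by (simp add: degree_def)
  qed
  moreover have "fst g \<subseteq> verts H" if "g \<in> edges H" for g using that by (simp add: eH vH)
  ultimately have "regular r (induced H {v \<in> verts H. reachable H u v})"
    unfolding regular_def using degree_component[of H u] by (auto simp: induced_def)
  moreover have "induced H {v \<in> verts H. reachable H u v} \<in> components H"
    using uW vH by (intro component_in_components) simp
  ultimately show False using irr unfolding H_def by blast
qed

text \<open>Each class of linked edges meets \<open>W\<close> or is a single edge disjoint from \<open>W\<close>.\<close>

lemma card_classes_le:
  assumes fF: "finite F" and fW: "finite W" and tW: "\<And>e. e \<in> F \<Longrightarrow> \<tau> e \<subseteq> W"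
  shows "card (F // linked F \<tau>) \<le> card W + card {e \<in> F. \<tau> e = {}}"
proof -
  let ?R = "linked F \<tau>"
  define g where "g v = {f. \<exists>e\<in>F. v \<in> \<tau> e \<and> (e, f) \<in> ?R}" for v
  have "F // ?R \<subseteq> g ` W \<union> (\<lambda>e. ?R `` {e}) ` {e \<in> F. \<tau> e = {}}"
  proof
    fix C assume "C \<in> F // ?R"
    then obtain e where e: "e \<in> F" "C = ?R `` {e}" by (rule quotientE)
    show "C \<in> g ` W \<union> (\<lambda>e. ?R `` {e}) ` {e \<in> F. \<tau> e = {}}"
    proof (cases "\<tau> e = {}")
      case False
      then obtain v where v: "v \<in> \<tau> e" by blast
      have "(e, f) \<in> ?R" if "e' \<in> F" "v \<in> \<tau> e'" "(e', f) \<in> ?R" for e' f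
      proof -
        have "(e, e') \<in> ?R" using e v that by (auto intro: linkedI)
        then show ?thesis using that equiv_linked[of F \<tau>] by (meson equivE transD)
      qed
      then have "C = g v" using e v by (auto simp: g_def)
      then show ?thesis using v tW[OF e(1)] by blast
    qed (use e in blast)
  qed
  then have "card (F // ?R) \<le> card (g ` W \<union> (\<lambda>e. ?R `` {e}) ` {e \<in> F. \<tau> e = {}})"
    using fF fW by (intro card_mono) auto
  also have "\<dots> \<le> card (g ` W) + card ((\<lambda>e. ?R `` {e}) ` {e \<in> F. \<tau> e = {}})" by (rule card_Un_le)
  also have "\<dots> \<le> card W + card {e \<in> F. \<tau> e = {}}" using fF fW by (intro add_mono card_image_le) auto
  finally show ?thesis .
qed

text \<open>The point to check is the number of pieces. At most \<open>m\<close> of them meet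
  \<open>W\<close>. The others are single edges that spend \<open>h \<ge> 4\<close> ends each out of
  \<open>r * (n - m)\<close>, so they are at most a quarter of that number. For
  \<open>r \<ge> 2\<close> and \<open>n \<ge> 3 * m\<close> the total stays within the tree
  bound.\<close>

lemma amalgam_of_colouring:
  fixes col c :: "'a hyperedge \<Rightarrow> nat" and V W :: "'a set" and lam h r :: nat
  defines "E \<equiv> edges (complete_hypergraph lam h V)"
  assumes fV: "finite V" and WV: "W \<subseteq> V" and n: "card V = n" and m: "card W = m" and h: "h \<ge> 4"
    and nm: "n \<ge> 3 * m" and r: "r \<ge> 2"
    and agree: "\<And>e. e \<in> E \<Longrightarrow> fst e \<subseteq> W \<Longrightarrow> col e = c e"
    and deg: "\<And>j v. j \<in> K \<Longrightarrow> v \<in> W \<Longrightarrow> card {e \<in> E. col e = j \<and> v \<in> fst e} = r"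
    and size: "\<And>j. j \<in> K \<Longrightarrow> h * card {e \<in> E. col e = j} = r * n"
    and irr: "\<And>j C. j \<in> K \<Longrightarrow> C \<in> components (color_class (complete_hypergraph lam h W) c j) \<Longrightarrow> \<not> regular r C"
  shows "amalgam h r lam E col K W (n - m) (\<lambda>e. fst e \<inter> W)"
  unfolding amalgam_def Let_def
proof (intro conjI ballI allI impI)
  have fW: "finite W" by (rule finite_subset[OF WV fV])
  have fE: "finite E" unfolding E_def by (rule finite_edges_complete[OF fV])
  have cE: "card (fst e) = h" "finite (fst e)" if "e \<in> E" for e
    using that h by (auto simp: E_def edges_complete intro: card_ge_0_finite)
  show le: "card (fst e \<inter> W) \<le> h" if "e \<in> E" for e
    using card_mono[OF cE(2)[OF that], of "fst e \<inter> W"] cE(1)[OF that] by simp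
  show "fst e \<inter> W \<subseteq> W" for e :: "'a hyperedge" by simp
  show "card {e \<in> E. fst e \<inter> W = S} = lam * (n - m choose (h - card S))" if "S \<subseteq> W \<and> card S \<le> h" for S
    using card_edges_with_trace[OF fV WV, of S h lam] that n m by (simp add: E_def)
  fix j assume j: "j \<in> K"
  define F where "F = {e \<in> E. col e = j}"
  have fF: "finite F" using fE by (simp add: F_def)
  have degF: "card {e \<in> F. v \<in> fst e} = r" if "v \<in> W" for v using deg[OF j that] by (simp add: F_def conj_assoc)
  show "card {e \<in> {e \<in> E. col e = j}. v \<in> fst e \<inter> W} = r" if "v \<in> W" for v
    using degF[OF that] that by (simp add: F_def)
  have "(\<Sum>e\<in>F. h - card (fst e \<inter> W)) + (\<Sum>e\<in>F. card (fst e \<inter> W)) = h * card F"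
    unfolding sum.distrib[symmetric] using le by (simp add: F_def)
  moreover have "(\<Sum>e\<in>F. card (fst e \<inter> W)) = r * m"
  proof -
    have "(\<Sum>e\<in>F. card (fst e \<inter> W)) = (\<Sum>v\<in>W. card {e \<in> F. v \<in> fst e \<inter> W})"
      by (rule sum_card_vertices[symmetric]) (use fF fW in auto)
    also have "\<dots> = (\<Sum>v\<in>W. r)" using degF by simp
    finally show ?thesis using m by simp
  qed
  ultimately have tot: "(\<Sum>e\<in>F. h - card (fst e \<inter> W)) = r * (n - m)"
    using size[OF j] by (simp add: F_def diff_mult_distrib2)
  then show "(\<Sum>e | e \<in> E \<and> col e = j. h - card (fst e \<inter> W)) = r * (n - m)" by (simp add: F_def)
  have "h * card {e \<in> F. fst e \<inter> W = {}} = (\<Sum>e | e \<in> F \<and> fst e \<inter> W = {}. h - card (fst e \<inter> W))" by simp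
  also have "\<dots> \<le> (\<Sum>e\<in>F. h - card (fst e \<inter> W))" using fF by (intro sum_mono2) auto
  finally have "h * card {e \<in> F. fst e \<inter> W = {}} \<le> r * (n - m)" using tot by simp
  then have none: "4 * card {e \<in> F. fst e \<inter> W = {}} \<le> r * (n - m)"
    using h by (meson le_trans mult_le_mono1)
  have "card (F // linked F (\<lambda>e. fst e \<inter> W)) \<le> m + card {e \<in> F. fst e \<inter> W = {}}"
    using card_classes_le[OF fF fW, of "\<lambda>e. fst e \<inter> W"] m by simp
  moreover have "m + card {e \<in> F. fst e \<inter> W = {}} \<le> (r - 1) * (n - m)"
  proof -
    \<comment> \<open>After the substitution, \<open>x = s * (n - m)\<close> and
      \<open>y = n - m\<close> can be treated as unknowns, and the estimate becomes linear.\<close>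
    obtain s where s: "r = s + 2" using r by (metis add.commute le_Suc_ex)
    define x y where "x = s * (n - m)" and "y = n - m"
    have "4 * m \<le> 2 * y" using nm by (simp add: y_def)
    moreover have "4 * card {e \<in> F. fst e \<inter> W = {}} \<le> x + 2 * y"
      using none unfolding s x_def y_def by (simp only: add_mult_distrib)
    moreover have "(r - 1) * (n - m) = x + y" unfolding s x_def y_def by simp
    ultimately show ?thesis by linarith
  qed
  ultimately show "card ({e \<in> E. col e = j} // linked {e \<in> E. col e = j} (\<lambda>e. fst e \<inter> W)) \<le> (r - 1) * (n - m) + 1"
    by (simp add: F_def)
  fix e assume "e \<in> {e \<in> E. col e = j}"
  then have eF: "e \<in> F" by (simp add: F_def)
  have h1: "h \<ge> 1" using h by simp
  obtain f where f: "(e, f) \<in> linked F (\<lambda>e. fst e \<inter> W)" "\<not> fst f \<subseteq> W"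
    using classes_reach_outside[OF WV h1 F_def[unfolded E_def] agree[unfolded E_def] degF irr[OF j] eF] by blast
  have fEf: "f \<in> E" using f by (auto simp: linked_def F_def)
  have "fst f \<inter> W \<subset> fst f" using f by blast
  then have "card (fst f \<inter> W) < h" using psubset_card_mono[OF cE(2)[OF fEf]] cE(1)[OF fEf] by simp
  then show "\<exists>f. (e, f) \<in> linked {e \<in> E. col e = j} (\<lambda>e. fst e \<inter> W) \<and> 0 < h - card (fst f \<inter> W)"
    using f(1) unfolding F_def zero_less_diff by blast
qed

section \<open>Connected factorizations\<close>

text \<open>Detachment gives an edge a new vertex set \<open>\<sigma> e\<close>, unrelated to its
  label \<open>fst e\<close> outside \<open>W\<close>. Since each set is attained exactly
  \<open>lam\<close> times, the copies of a set can be matched with the edges detached to it. Inside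
  \<open>W\<close> the matching has to be the identity for the given colours to be kept.\<close>

lemma relabel_edges:
  fixes V W :: "'a set" and lam h :: nat
  defines "E \<equiv> edges (complete_hypergraph lam h V)"
  assumes fV: "finite V" and \<sigma>: "\<And>e. e \<in> E \<Longrightarrow> \<sigma> e \<subseteq> V \<and> card (\<sigma> e) = h"
    and fix\<sigma>: "\<And>e. e \<in> E \<Longrightarrow> fst e \<subseteq> W \<Longrightarrow> \<sigma> e = fst e"
    and fib: "\<And>S. S \<subseteq> V \<Longrightarrow> card S = h \<Longrightarrow> card {e \<in> E. \<sigma> e = S} = lam"
  shows "\<exists>B. bij_betw B E E \<and> (\<forall>e\<in>E. \<sigma> (B e) = fst e) \<and> (\<forall>e\<in>E. fst e \<subseteq> W \<longrightarrow> B e = e)"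
proof -
  have fE: "finite E" unfolding E_def by (rule finite_edges_complete[OF fV])
  define SS where "SS = {S. S \<subseteq> V \<and> card S = h}"
  have E: "E = SS \<times> {..<lam}" by (simp add: E_def SS_def edges_complete)
  have "\<exists>b. bij_betw b {..<lam} {e \<in> E. \<sigma> e = S} \<and> (S \<subseteq> W \<longrightarrow> (\<forall>i<lam. b i = (S, i)))" if S: "S \<in> SS" for S
  proof (cases "S \<subseteq> W")
    case True
    have inj: "inj_on (\<lambda>i. (S, i)) {..<lam}" by (simp add: inj_on_def)
    have "(\<lambda>i. (S, i)) ` {..<lam} \<subseteq> {e \<in> E. \<sigma> e = S}" using True S fix\<sigma> by (auto simp: E)
    moreover have "card ((\<lambda>i. (S, i)) ` {..<lam}) = card {e \<in> E. \<sigma> e = S}"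
      using fib[of S] S card_image[OF inj] by (simp add: SS_def)
    \<comment> \<open>The copies of a set \<open>S\<close> inside \<open>W\<close> are detached to
      \<open>S\<close> itself, and as they already number \<open>lam\<close>, no other edge
      is.\<close>
    ultimately have "(\<lambda>i. (S, i)) ` {..<lam} = {e \<in> E. \<sigma> e = S}" using fE by (intro card_subset_eq) auto
    then show ?thesis using inj by (intro exI[of _ "\<lambda>i. (S, i)"]) (simp add: bij_betw_def)
  next
    case False
    have "card {..<lam} = card {e \<in> E. \<sigma> e = S}" using fib[of S] S by (simp add: SS_def)
    then have "\<exists>b. bij_betw b {..<lam} {e \<in> E. \<sigma> e = S}" using fE by (intro finite_same_card_bij) auto
    then show ?thesis using False by simp
  qed
  then have "\<forall>S\<in>SS. \<exists>b. bij_betw b {..<lam} {e \<in> E. \<sigma> e = S} \<and> (S \<subseteq> W \<longrightarrow> (\<forall>i<lam. b i = (S, i)))"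
    by (rule ballI)
  from bchoice[OF this] obtain b where
    b: "\<And>S. S \<in> SS \<Longrightarrow> bij_betw (b S) {..<lam} {e \<in> E. \<sigma> e = S}"
       "\<And>S i. S \<in> SS \<Longrightarrow> S \<subseteq> W \<Longrightarrow> i < lam \<Longrightarrow> b S i = (S, i)" by blast
  define B where "B e = b (fst e) (snd e)" for e
  have Bin: "B e \<in> E \<and> \<sigma> (B e) = fst e" if "e \<in> E" for e
  proof -
    have "fst e \<in> SS" "snd e \<in> {..<lam}" using that by (auto simp: E)
    then have "b (fst e) (snd e) \<in> {e' \<in> E. \<sigma> e' = fst e}" using b(1) by (meson bij_betwE)
    then show ?thesis by (simp add: B_def)
  qed
  have "inj_on B E"
  proof (rule inj_onI)
    fix e f assume ef: "e \<in> E" "f \<in> E" "B e = B f"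
    then have S: "fst e = fst f" using Bin by metis
    have "fst e \<in> SS" "snd e \<in> {..<lam}" "snd f \<in> {..<lam}" using ef by (auto simp: E)
    then have "snd e = snd f" using b(1)[of "fst e"] ef(3) S unfolding B_def bij_betw_def
      by (metis inj_onD)
    then show "e = f" using S by (simp add: prod_eq_iff)
  qed
  moreover have "B ` E = E"
  proof
    show "B ` E \<subseteq> E" using Bin by blast
    show "E \<subseteq> B ` E"
    proof
      fix e assume e: "e \<in> E"
      have S: "\<sigma> e \<in> SS" using \<sigma>[OF e] by (simp add: SS_def)
      have "e \<in> b (\<sigma> e) ` {..<lam}" using b(1)[OF S] e by (simp add: bij_betw_def)
      then obtain i where "i < lam" "e = b (\<sigma> e) i" by blast
      then have "(\<sigma> e, i) \<in> E" "e = B (\<sigma> e, i)" using S by (auto simp: E B_def)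
      then show "e \<in> B ` E" by blast
    qed
  qed
  moreover have "B e = e" if "e \<in> E" "fst e \<subseteq> W" for e
    using that b(2)[of "fst e" "snd e"] by (auto simp: E B_def)
  ultimately show ?thesis using Bin by (intro exI[of _ B]) (simp add: bij_betw_def)
qed

text \<open>The colouring is \<open>col\<close> transported along the matching, so a class of
  \<open>d\<close> is isomorphic to the detached class of \<open>col\<close>. As
  \<open>r \<ge> 1\<close>, every vertex lies on an edge of each class, which turns linkedness of
  edges into reachability of vertices.\<close>

lemma connected_factorization_of_detachment:
  fixes V W :: "'a set" and k lam h r :: nat and col :: "'a hyperedge \<Rightarrow> nat"
  defines "E \<equiv> edges (complete_hypergraph lam h V)"
  assumes fV: "finite V" and V: "V \<noteq> {}" and r: "r \<ge> 1" and colK: "col ` E \<subseteq> {1..k}"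
    and \<sigma>: "\<forall>e\<in>E. \<sigma> e \<subseteq> V \<and> card (\<sigma> e) = h"
    and fix\<sigma>: "\<forall>e\<in>E. fst e \<subseteq> W \<longrightarrow> \<sigma> e = fst e"
    and fib: "\<forall>S. S \<subseteq> V \<and> card S = h \<longrightarrow> card {e \<in> E. \<sigma> e = S} = lam"
    and colour: "\<forall>j\<in>{1..k}. (\<forall>v\<in>V. card {e \<in> E. col e = j \<and> v \<in> \<sigma> e} = r) \<and>
      (\<forall>e\<in>E. \<forall>f\<in>E. col e = j \<and> col f = j \<longrightarrow> (e, f) \<in> linked {e \<in> E. col e = j} \<sigma>)"
  shows "\<exists>d. connected_factorization k r (complete_hypergraph lam h V) d \<and>
    (\<forall>e\<in>E. fst e \<subseteq> W \<longrightarrow> d e = col e)"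
proof -
  obtain B where B: "bij_betw B E E" "\<forall>e\<in>E. \<sigma> (B e) = fst e" "\<forall>e\<in>E. fst e \<subseteq> W \<longrightarrow> B e = e"
    using relabel_edges[of V lam h \<sigma> W] fV \<sigma> fix\<sigma> fib unfolding E_def by blast
  define d where "d e = col (B e)" for e
  have BE: "B e \<in> E" if "e \<in> E" for e using B(1) that by (meson bij_betwE)
  have sur: "\<exists>e'\<in>E. B e' = e" if "e \<in> E" for e using B(1) that by (metis bij_betw_imp_surj_on imageE)
  have cls: "is_factor r (complete_hypergraph lam h V) (color_class (complete_hypergraph lam h V) d i) \<and>
     connected_hypergraph (color_class (complete_hypergraph lam h V) d i)" if i: "i \<in> {1..k}" for i
  proof -
    define H where "H = color_class (complete_hypergraph lam h V) d i"
    define F where "F = {e \<in> E. col e = i}"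
    have eH: "edges H = {e \<in> E. d e = i}" by (simp add: H_def edges_color_class E_def)
    have vH: "verts H = V" by (simp add: H_def verts_color_class verts_complete)
    have degF: "card {e \<in> F. v \<in> \<sigma> e} = r" if "v \<in> V" for v
      using colour i that by (simp add: F_def conj_assoc)
    have deg: "degree H v = r" if v: "v \<in> V" for v
    proof -
      have "B ` {e \<in> edges H. v \<in> fst e} = {e \<in> F. v \<in> \<sigma> e}"
      proof (intro set_eqI iffI)
        fix f assume "f \<in> {e \<in> F. v \<in> \<sigma> e}"
        then have f: "f \<in> E" "col f = i" "v \<in> \<sigma> f" by (auto simp: F_def)
        then obtain e where "e \<in> E" "B e = f" using sur by blast
        then have "e \<in> {e \<in> edges H. v \<in> fst e}" "f = B e" using f B(2) by (auto simp: eH d_def)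
        then show "f \<in> B ` {e \<in> edges H. v \<in> fst e}" by blast
      qed (use BE B(2) in \<open>auto simp: eH d_def F_def\<close>)
      moreover have "inj_on B {e \<in> edges H. v \<in> fst e}"
        using B(1) by (auto simp: bij_betw_def eH intro: inj_on_subset)
      ultimately have "card {e \<in> edges H. v \<in> fst e} = card {e \<in> F. v \<in> \<sigma> e}"
        using card_image by fastforce
      then show ?thesis using degF[OF v] by (simp add: degree_def)
    qed
    have adj: "reachable H u w" if ve: "reachable H u v" "e \<in> F" "v \<in> \<sigma> e" "w \<in> \<sigma> e" for u v w e
    proof -
      have "e \<in> E" using ve by (simp add: F_def)
      then obtain e' where e': "e' \<in> E" "B e' = e" using sur by blast
      then have "e' \<in> edges H" "fst e' = \<sigma> e" using ve B(2) by (auto simp: eH d_def F_def)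
      then show ?thesis using ve reachable_step by metis
    qed
    have meets: "\<exists>e\<in>F. v \<in> \<sigma> e" if v: "v \<in> V" for v
    proof (rule ccontr)
      assume "\<not> ?thesis"
      then have "{e \<in> F. v \<in> \<sigma> e} = {}" by blast
      then have "card {e \<in> F. v \<in> \<sigma> e} = 0" by (simp only: card.empty)
      then show False using degF[OF v] r by simp
    qed
    have "reachable H u v" if uv: "u \<in> V" "v \<in> V" for u v
    proof -
      obtain e f where e: "e \<in> F" "u \<in> \<sigma> e" and f: "f \<in> F" "v \<in> \<sigma> f" using meets uv by blast
      have "(e, f) \<in> linked F \<sigma>" using colour i e f by (simp add: F_def)
      then have "(e, f) \<in> {(e, f). e \<in> F \<and> f \<in> F \<and> \<sigma> e \<inter> \<sigma> f \<noteq> {}}\<^sup>*" by (simp add: linked_def)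
      then have "\<forall>w\<in>\<sigma> f. reachable H u w"
      proof (induction rule: rtrancl_induct)
        case base
        have "reachable H u u" by (simp add: reachable_def)
        then show ?case using adj e by blast
      next
        case (step f g)
        then obtain y where "y \<in> \<sigma> f" "y \<in> \<sigma> g" "g \<in> F" by blast
        then show ?case using adj step.IH by blast
      qed
      then show ?thesis using f by blast
    qed
    then have "connected_hypergraph H" using V by (simp add: connected_hypergraph_def vH)
    moreover have "is_factor r (complete_hypergraph lam h V) H"
      using deg by (auto simp: is_factor_def regular_def vH verts_complete eH E_def)
    ultimately show ?thesis unfolding H_def by blast
  qed
  have "d \<in> E \<rightarrow> {1..k}" using colK BE by (auto simp: d_def)
  then have "connected_factorization k r (complete_hypergraph lam h V) d"
    using cls by (simp add: connected_factorization_def E_def)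
  moreover have "\<forall>e\<in>E. fst e \<subseteq> W \<longrightarrow> d e = col e" using B(3) by (simp add: d_def)
  ultimately show ?thesis by blast
qed

section \<open>Necessity of the two conditions, and the case of degree one\<close>

lemma num_colors_pos:
  assumes "d \<in> edges (complete_hypergraph lam h V) \<rightarrow> {1..k}" "lam > 0" "h \<le> card V"
  shows "1 \<le> (k :: nat)"
proof -
  obtain S where "S \<subseteq> V" "card S = h" using assms(3) by (metis obtain_subset_with_card_n)
  then have "(S, 0) \<in> edges (complete_hypergraph lam h V)" using assms(2) by (auto simp: edges_complete)
  then have "d (S, 0) \<in> {1..k}" using assms(1) by blast
  then show ?thesis by auto
qed

text \<open>The first divisibility counts the incidences of vertices with one class, the second
  counts the edges at one vertex class by class. The latter shows that the rounding division in
  \<open>num_colors\<close> was exact.\<close>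

lemma factorization_admissible:
  assumes fV: "finite V" and h: "1 \<le> h" "h \<le> card V" and lam: "lam > 0"
    and d: "connected_factorization (num_colors h (card V) r lam) r (complete_hypergraph lam h V) d"
  shows "admissible h (card V) r lam"
proof -
  define k where "k = num_colors h (card V) r lam"
  define E where "E = edges (complete_hypergraph lam h V)"
  have fE: "finite E" unfolding E_def by (rule finite_edges_complete[OF fV])
  have dE: "d ` E \<subseteq> {1..k}" "d \<in> E \<rightarrow> {1..k}" using d by (auto simp: connected_factorization_def k_def E_def)
  have deg: "card {e \<in> E. d e = i \<and> v \<in> fst e} = r" if "i \<in> {1..k}" "v \<in> V" for i v
    using d that
    by (simp add: connected_factorization_def k_def is_factor_def regular_def verts_color_class verts_complete
        degree_def edges_color_class E_def conj_assoc)
  \<comment> \<open>A class to count in must exist, whereas the integer division in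
    \<open>num_colors\<close> could by itself yield 0.\<close>
  have k1: "1 \<le> k" using num_colors_pos[OF dE(2)[unfolded E_def] lam h(2)] .
  obtain v where v: "v \<in> V" using h by fastforce
  have "r * k = (\<Sum>i\<in>{1..k}. card {e \<in> E. d e = i \<and> v \<in> fst e})" using deg v by simp
  also have "\<dots> = card {e \<in> E. v \<in> fst e}" using sum_card_colours[OF fE _ dE(1)] by simp
  also have "\<dots> = lam * ((card V - 1) choose (h - 1))"
    unfolding E_def using v h fV by (intro degree_complete) auto
  finally have "r dvd lam * ((card V - 1) choose (h - 1))" by (metis dvd_triv_left)
  moreover have "h dvd r * card V"
  proof -
    have "r * card V = (\<Sum>v\<in>V. card {e \<in> {e \<in> E. d e = 1}. v \<in> fst e})" using deg k1 by simp
    also have "\<dots> = (\<Sum>e | e \<in> E \<and> d e = 1. card (fst e))"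
      using fE fV by (intro sum_card_vertices) (auto simp: E_def edges_complete)
    also have "\<dots> = (\<Sum>e | e \<in> E \<and> d e = 1. h)" by (rule sum.cong) (auto simp: E_def edges_complete)
    finally show ?thesis by simp
  qed
  ultimately show ?thesis by (simp add: admissible_def)
qed

text \<open>A vertex of an \<open>r\<close>-regular component within \<open>W\<close> has no further
  edge of its class in the whole factor. So no path of the class leaves the component, although it
  should reach a vertex outside \<open>W\<close>.\<close>

lemma factorization_no_regular_component:
  assumes fV: "finite V" and WV: "W \<subset> V" and i: "i \<in> {1..k}"
    and d: "connected_factorization k r (complete_hypergraph lam h V) d"
    and agree: "\<forall>e\<in>edges (complete_hypergraph lam h W). d e = c e"
    and C: "C \<in> components (color_class (complete_hypergraph lam h W) c i)"
  shows "\<not> regular r C"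
proof
  assume reg: "regular r C"
  define H where "H = color_class (complete_hypergraph lam h V) d i"
  define HW where "HW = color_class (complete_hypergraph lam h W) c i"
  have W: "W \<subseteq> V" using WV by blast
  have vW: "verts HW = W" by (simp add: HW_def verts_color_class verts_complete)
  have eW: "edges HW = {e \<in> edges H. fst e \<subseteq> W}"
    using agree unfolding H_def HW_def edges_color_class edges_complete_within[OF W] by auto
  have fin: "finite (edges H)"
    unfolding H_def edges_color_class using finite_edges_complete[OF fV, of lam h] by simp
  obtain u where u: "u \<in> W" "C = induced HW {v \<in> W. reachable HW u v}"
    using C unfolding components_def HW_def[symmetric] vW by blast
  obtain z where z: "z \<in> V" "z \<notin> W" using WV by blast
  have con: "connected_hypergraph H" and deg: "\<And>v. v \<in> V \<Longrightarrow> degree H v = r"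
    using d i by (auto simp: connected_factorization_def H_def is_factor_def regular_def verts_color_class)
     (simp add: verts_complete)
  have "verts H = V" by (simp add: H_def verts_color_class verts_complete)
  then have "reachable H u z" using con u z W by (auto simp: connected_hypergraph_def)
  then have "z \<in> {v \<in> W. reachable HW u v}"
  proof (induction rule: reachable_induct)
    case base
    show ?case using u by (simp add: reachable_def)
  next
    case (step v w e)
    have "degree C v = r" using reg step(1) by (simp add: regular_def u(2) induced_def)
    moreover have "degree H v = r" using step(1) W deg by blast
    ultimately have "card {e \<in> edges C. v \<in> fst e} = card {e \<in> edges H. v \<in> fst e}" by (simp add: degree_def)
    moreover have "{e \<in> edges C. v \<in> fst e} \<subseteq> {e \<in> edges H. v \<in> fst e}" by (auto simp: u(2) induced_def eW)
    ultimately have "{e \<in> edges C. v \<in> fst e} = {e \<in> edges H. v \<in> fst e}" using fin by (intro card_subset_eq) auto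
    then have "e \<in> edges C" using step by blast
    then show ?case using step(4) by (auto simp: u(2) induced_def)
  qed
  then show False using z by blast
qed

text \<open>For \<open>r = 1\<close> both sides of the equivalence fail, because any edge within \<open>W\<close> is a regular component.\<close>

lemma regular_component_degree_one:
  assumes fW: "finite W" and lam: "lam > 0" and h: "1 \<le> h" "h \<le> card W"
    and c: "partial_factorization k 1 (complete_hypergraph lam h W) c"
  shows "\<exists>i\<in>{1..k}. \<exists>C\<in>components (color_class (complete_hypergraph lam h W) c i). regular 1 C"
proof -
  obtain S where S: "S \<subseteq> W" "card S = h" using h by (metis obtain_subset_with_card_n)
  define e where "e = (S, 0 :: nat)"
  have e: "e \<in> edges (complete_hypergraph lam h W)" using S lam by (simp add: e_def edges_complete)
  define H where "H = color_class (complete_hypergraph lam h W) c (c e)"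
  have ce: "c e \<in> {1..k}" using c e by (auto simp: partial_factorization_def)
  have vH: "verts H = W" by (simp add: H_def verts_color_class verts_complete)
  have eH: "e \<in> edges H" using e by (simp add: H_def edges_color_class)
  have fin: "finite (edges H)" unfolding H_def edges_color_class using finite_edges_complete[OF fW, of lam h] by simp
  \<comment> \<open>As degrees in the class are at most 1, \<open>e\<close> is the only edge of its
    colour that meets \<open>S\<close>; its vertex set is therefore a component.\<close>
  have only: "g = e" if "g \<in> edges H" "v \<in> fst g" "v \<in> S" for g v
  proof -
    have "v \<in> W" using that S by blast
    then have "card {f \<in> edges H. v \<in> fst f} \<le> Suc 0"
      using c ce by (simp add: partial_factorization_def verts_complete degree_def H_def)
    moreover have "finite {f \<in> edges H. v \<in> fst f}" using fin by simp
    ultimately have "\<forall>f\<in>{f \<in> edges H. v \<in> fst f}. \<forall>g\<in>{f \<in> edges H. v \<in> fst f}. f = g"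
      using card_le_Suc0_iff_eq by blast
    moreover have "e \<in> {f \<in> edges H. v \<in> fst f}" "g \<in> {f \<in> edges H. v \<in> fst f}"
      using that eH by (auto simp: e_def)
    ultimately show ?thesis by blast
  qed
  obtain u where u: "u \<in> S" using S h by fastforce
  have inS: "v \<in> S" if "reachable H u v" for v
    using that
  proof (induction rule: reachable_induct)
    case (step v w g)
    then have "g = e" using only by blast
    then show ?case using step by (simp add: e_def)
  qed (rule u)
  have "degree H v = 1" if "v \<in> S" for v
  proof -
    have "v \<in> fst e" using that by (simp add: e_def)
    then have "{g \<in> edges H. v \<in> fst g} = {e}" using only[OF _ _ that] eH by blast
    then show ?thesis by (simp add: degree_def)
  qed
  moreover have "fst g \<subseteq> verts H" if "g \<in> edges H" for g
    using that by (auto simp: H_def edges_color_class verts_color_class verts_complete edges_complete)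
  ultimately have "regular 1 (induced H {v \<in> verts H. reachable H u v})"
    unfolding regular_def using degree_component[of H u] inS by (auto simp: induced_def)
  moreover have "induced H {v \<in> verts H. reachable H u v} \<in> components H"
    using u S vH by (intro component_in_components) auto
  ultimately show ?thesis using ce unfolding H_def by blast
qed

theorem theorem7p9:
  fixes n m r lam :: nat and V W :: "'a set" and c :: "'a hyperedge \<Rightarrow> nat"
  assumes "n > 0" and "r > 0" and "lam > 0" and "m > 4"
    and "real n \<ge> 4.847323 * real m"
    and "finite V" and "card V = n" and "W \<subseteq> V" and "card W = m"
    and "partial_factorization (num_colors 4 n r lam) r (complete_hypergraph lam 4 W) c"
  shows "(\<exists>d. connected_factorization (num_colors 4 n r lam) r (complete_hypergraph lam 4 V) d \<and>
              (\<forall>e \<in> edges (complete_hypergraph lam 4 W). d e = c e))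
     \<longleftrightarrow>
         admissible 4 n r lam \<and>
         (\<forall>i \<in> {1..num_colors 4 n r lam}.
            \<forall>C \<in> components (color_class (complete_hypergraph lam 4 W) c i). \<not> regular r C)"
proof -
  define k where "k = num_colors 4 n r lam"
  have n4m: "n \<ge> 4 * m"
  proof -
    have "1000000 * real n \<ge> 4847323 * real m" using assms(5) by (simp add: field_simps)
    then have "real n \<ge> 4 * real m" by linarith
    then show ?thesis by linarith
  qed
  have n4: "n \<ge> 4" using n4m \<open>m > 4\<close> by linarith
  have fW: "finite W" by (rule finite_subset[OF assms(8,6)])
  show ?thesis unfolding k_def[symmetric]
  proof (intro iffI conjI ballI)
    assume "\<exists>d. connected_factorization k r (complete_hypergraph lam 4 V) d \<and>
              (\<forall>e \<in> edges (complete_hypergraph lam 4 W). d e = c e)"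
    then obtain d where d: "connected_factorization k r (complete_hypergraph lam 4 V) d"
      "\<forall>e \<in> edges (complete_hypergraph lam 4 W). d e = c e" by blast
    show "admissible 4 n r lam"
      using factorization_admissible[of V 4 lam r d] d(1) assms n4 by (simp add: k_def)
    \<comment> \<open>A vertex outside \<open>W\<close> exists because \<open>n \<ge> 4 * m\<close>
      and \<open>n > 0\<close>.\<close>
    have "W \<noteq> V" using assms(1,7,9) n4m by auto
    then have "W \<subset> V" using assms(8) by blast
    then show "\<not> regular r C"
      if "i \<in> {1..k}" "C \<in> components (color_class (complete_hypergraph lam 4 W) c i)" for i C
      using factorization_no_regular_component[OF assms(6) _ that(1) d that(2)] by blast
  next
    assume R: "admissible 4 n r lam \<and>
         (\<forall>i \<in> {1..k}. \<forall>C \<in> components (color_class (complete_hypergraph lam 4 W) c i). \<not> regular r C)"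
    define E where "E = edges (complete_hypergraph lam 4 V)"
    have fE: "finite E" unfolding E_def by (rule finite_edges_complete[OF assms(6)])
    have EW: "edges (complete_hypergraph lam 4 W) = {e \<in> E. fst e \<subseteq> W}"
      unfolding E_def by (rule edges_complete_within[OF assms(8)])
    have "r \<noteq> 1"
    proof
      assume "r = 1"
      then have "\<exists>i\<in>{1..k}. \<exists>C\<in>components (color_class (complete_hypergraph lam 4 W) c i). regular 1 C"
        using assms fW by (intro regular_component_degree_one) (auto simp: k_def)
      then show False using R \<open>r = 1\<close> by blast
    qed
    then have r: "r \<ge> 2" using \<open>r > 0\<close> by linarith
    have adm: "4 dvd r * n" "r dvd lam * ((n - 1) choose 3)" using R by (simp_all add: admissible_def)
    \<comment> \<open>Divisibility makes the division in \<open>num_colors\<close> exact, so the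
      colours account for the full degree of a vertex.\<close>
    then have rk: "r * card {1..k} = lam * ((n - 1) choose 3)" by (simp add: k_def num_colors_def)
    have cin: "c e \<in> {1..k}" if "e \<in> E" "fst e \<subseteq> W" for e
      using assms(10) that EW by (auto simp: partial_factorization_def k_def)
    have cdeg: "card {e \<in> E. fst e \<subseteq> W \<and> c e = j \<and> v \<in> fst e} \<le> r" if "j \<in> {1..k}" "v \<in> W" for j v
      using assms(10) that
      by (simp add: partial_factorization_def k_def verts_complete degree_def edges_color_class EW conj_assoc)
    obtain col where col: "\<forall>e\<in>E. fst e \<subseteq> W \<longrightarrow> col e = c e" "col ` E \<subseteq> {1..k}"
      "\<forall>j\<in>{1..k}. (\<forall>v\<in>W. card {e \<in> E. col e = j \<and> v \<in> fst e} = r) \<and> 4 * card {e \<in> E. col e = j} = r * n"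
      using extend_colouring[OF assms(6,8,7,9,4,5,3) finite_atLeastAtMost adm(1) rk cin[unfolded E_def]
          cdeg[unfolded E_def]] unfolding E_def by blast
    have am: "amalgam 4 r lam E col {1..k} W (n - m) (\<lambda>e. fst e \<inter> W)"
      unfolding E_def
    proof (rule amalgam_of_colouring[OF assms(6,8,7,9)])
      show "\<And>j C. j \<in> {1..k} \<Longrightarrow> C \<in> components (color_class (complete_hypergraph lam 4 W) c j) \<Longrightarrow> \<not> regular r C"
        using R by blast
    qed (use n4m r col in \<open>auto simp: E_def\<close>)
    obtain u where u: "n - m = Suc u" using n4m \<open>m > 4\<close> by (cases "n - m") auto
    have cVW: "card (V - W) = Suc u" using assms fW u by (simp add: card_Diff_subset)
    obtain \<sigma> where \<sigma>: "\<forall>e\<in>E. \<sigma> e \<subseteq> V \<and> card (\<sigma> e) = 4" "\<forall>e\<in>E. card (fst e \<inter> W) = 4 \<longrightarrow> \<sigma> e = fst e \<inter> W"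
      "\<forall>S. S \<subseteq> V \<and> card S = 4 \<longrightarrow> card {e \<in> E. \<sigma> e = S} = lam"
      "\<forall>j\<in>{1..k}. (\<forall>v\<in>V. card {e \<in> E. col e = j \<and> v \<in> \<sigma> e} = r) \<and>
      (\<forall>e\<in>E. \<forall>f\<in>E. col e = j \<and> col f = j \<longrightarrow> (e, f) \<in> linked {e \<in> E. col e = j} \<sigma>)"
      using detachment_complete[OF am[unfolded u] fE assms(6,8) cVW _ _ col(2)] r by auto
    have fix\<sigma>: "\<forall>e\<in>E. fst e \<subseteq> W \<longrightarrow> \<sigma> e = fst e"
    proof (intro ballI impI)
      fix e assume e: "e \<in> E" "fst e \<subseteq> W"
      then have "fst e \<inter> W = fst e" "card (fst e) = 4" by (auto simp: E_def edges_complete)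
      then show "\<sigma> e = fst e" using \<sigma>(2) e(1) by simp
    qed
    have V: "V \<noteq> {}" using assms by auto
    have r1: "r \<ge> 1" using r by simp
    obtain d where "connected_factorization k r (complete_hypergraph lam 4 V) d" "\<forall>e\<in>E. fst e \<subseteq> W \<longrightarrow> d e = col e"
      using connected_factorization_of_detachment[OF assms(6) V r1 col(2)[unfolded E_def] \<sigma>(1)[unfolded E_def]
          fix\<sigma>[unfolded E_def] \<sigma>(3,4)[unfolded E_def]] unfolding E_def by blast
    then show "\<exists>d. connected_factorization k r (complete_hypergraph lam 4 V) d \<and>
              (\<forall>e \<in> edges (complete_hypergraph lam 4 W). d e = c e)"
      using col(1) unfolding EW by auto
  qed
qed

end
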